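(* For every $f\in L^2(\mathbb{R}^N)$, $$(\mathcal{Q}_{-\boldsymbol{\Lambda}}\circ\mathcal{Q}_{\boldsymbol{\Lambda}})(f)=f.$$
   Context: Let $N\ge 1$ and $\boldsymbol{\Lambda}=(\Lambda_1,\dots,\Lambda_N)$ with $\Lambda_k=(a_k,b_k,c_k,d_k,e_k)\in\mathbb{R}^5$ and $b_k\neq 0$ for $k=1,\dots,N$. With principal square roots, for $\boldsymbol{\omega},\boldsymbol{x}\in\mathbb{R}^N$ put $$\mathcal{K}_{\boldsymbol{\Lambda}}(\boldsymbol{\omega},\boldsymbol{x})=\prod_{k=1}^N\sqrt{\tfrac{b_k}{2\pi i}}\;e^{i(a_kx_k^2+b_kx_k\omega_k+c_k\omega_k^2+d_kx_k+e_k\omega_k)},$$ $$\mathcal{K}_{-\boldsymbol{\Lambda}}(\boldsymbol{\omega},\boldsymbol{x})=\prod_{k=1}^N\sqrt{\tfrac{b_k i}{2\pi}}\;e^{-i(a_kx_k^2+b_kx_k\omega_k+c_k\omega_k^2+d_kx_k+e_k\omega_k)}.$$ On $L^1(\mathbb{R}^N)$, $(\mathcal{Q}_{\boldsymbol{\Lambda}}f)(\boldsymbol{\omega})=\int_{\mathbb{R}^N}\mathcal{K}_{\boldsymbol{\Lambda}}(\boldsymbol{\omega},\boldsymbol{x})f(\boldsymbol{x})\,d\boldsymbol{x}$ (the multidimensional QPFT) and $(\mathcal{Q}_{-\boldsymbol{\Lambda}}F)(\boldsymbol{x})=\int_{\mathbb{R}^N}\mathcal{K}_{-\boldsymbol{\Lambda}}(\boldsymbol{\omega},\boldsymbol{x})F(\boldsymbol{\omega})\,d\boldsymbol{\omega}$.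 On $L^2(\mathbb{R}^N)$, both $\mathcal{Q}_{\boldsymbol{\Lambda}}$ and $\mathcal{Q}_{-\boldsymbol{\Lambda}}$ denote the continuous extensions to $L^2(\mathbb{R}^N)$ of their restrictions to $L^1(\mathbb{R}^N)\cap L^2(\mathbb{R}^N)$. *)

theory Defs
  imports "HOL-Analysis.Analysis"
begin

text \<open>The parameter \<open>\<Lambda>\<^sub>k = (a\<^sub>k, b\<^sub>k, c\<^sub>k, d\<^sub>k, e\<^sub>k)\<close> of one coordinate; a parameter
  \<open>\<Lambda>\<close> in dimension \<open>N = CARD('n)\<close> is a function from the index type \<open>'n\<close>.\<close>

record qp_param =
  par_a :: real
  par_b :: real
  par_c :: real
  par_d :: real
  par_e :: real

definition qp_phase :: "qp_param \<Rightarrow> real \<Rightarrow> real \<Rightarrow> real" where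
  "qp_phase p w x =
     par_a p * x\<^sup>2 + par_b p * x * w + par_c p * w\<^sup>2 + par_d p * x + par_e p * w"

definition qpft_kernel ::
    "('n::finite \<Rightarrow> qp_param) \<Rightarrow> real ^ 'n \<Rightarrow> real ^ 'n \<Rightarrow> complex" where
  "qpft_kernel \<Lambda> \<omega> x =
     (\<Prod>k\<in>UNIV. csqrt (of_real (par_b (\<Lambda> k)) / (2 * of_real pi * \<i>))
        * exp (\<i> * of_real (qp_phase (\<Lambda> k) (\<omega> $ k) (x $ k))))"

definition qpft_kernel_neg ::
    "('n::finite \<Rightarrow> qp_param) \<Rightarrow> real ^ 'n \<Rightarrow> real ^ 'n \<Rightarrow> complex" where
  "qpft_kernel_neg \<Lambda> \<omega> x =
     (\<Prod>k\<in>UNIV. csqrt (of_real (par_b (\<Lambda> k)) * \<i> / (2 * of_real pi))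
        * exp (- (\<i> * of_real (qp_phase (\<Lambda> k) (\<omega> $ k) (x $ k)))))"

definition qpft_L1 ::
    "('n::finite \<Rightarrow> qp_param) \<Rightarrow> (real ^ 'n \<Rightarrow> complex) \<Rightarrow> real ^ 'n \<Rightarrow> complex" where
  "qpft_L1 \<Lambda> f \<omega> = (LINT x|lebesgue. qpft_kernel \<Lambda> \<omega> x * f x)"

definition qpft_neg_L1 ::
    "('n::finite \<Rightarrow> qp_param) \<Rightarrow> (real ^ 'n \<Rightarrow> complex) \<Rightarrow> real ^ 'n \<Rightarrow> complex" where
  "qpft_neg_L1 \<Lambda> F x = (LINT \<omega>|lebesgue. qpft_kernel_neg \<Lambda> \<omega> x * F \<omega>)"

text \<open>Elements of \<open>L\<^sup>2(\<real>\<^sup>N)\<close> are represented by functions; equality in \<open>L\<^sup>2(\<real>\<^sup>N)\<close> is equality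
  almost everywhere.\<close>

definition L2_space :: "('a::euclidean_space \<Rightarrow> complex) set" where
  "L2_space = {f \<in> borel_measurable lebesgue. integrable lebesgue (\<lambda>x. (cmod (f x))\<^sup>2)}"

definition L2_norm :: "('a::euclidean_space \<Rightarrow> complex) \<Rightarrow> real" where
  "L2_norm f = sqrt (LINT x|lebesgue. (cmod (f x))\<^sup>2)"

text \<open>\<open>T\<close> is a continuous map from \<open>L\<^sup>2\<close> to \<open>L\<^sup>2\<close> agreeing with \<open>Q\<close> on \<open>L\<^sup>1 \<inter> L\<^sup>2\<close>. The continuity
  clause also makes \<open>T\<close> compatible with equality almost everywhere: take \<open>g\<close> at distance 0 from \<open>f\<close>.\<close>

definition is_L2_extension ::
    "(('a::euclidean_space \<Rightarrow> complex) \<Rightarrow> ('a \<Rightarrow> complex))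
      \<Rightarrow> (('a \<Rightarrow> complex) \<Rightarrow> ('a \<Rightarrow> complex)) \<Rightarrow> bool" where
  "is_L2_extension Q T \<longleftrightarrow>
     (\<forall>f\<in>L2_space. T f \<in> L2_space) \<and>
     (\<forall>f\<in>L2_space. integrable lebesgue f \<longrightarrow> (AE x in lebesgue. T f x = Q f x)) \<and>
     (\<forall>f\<in>L2_space. \<forall>\<epsilon>>0. \<exists>\<delta>>0. \<forall>g\<in>L2_space.
        L2_norm (\<lambda>x. g x - f x) < \<delta> \<longrightarrow> L2_norm (\<lambda>x. T g x - T f x) < \<epsilon>)"

text \<open>Since \<open>L\<^sup>1 \<inter> L\<^sup>2\<close> is dense in \<open>L\<^sup>2\<close>, two continuous extensions of the same \<open>Q\<close> give almost
  everywhere equal values, so the choice below only selects representatives. If \<open>Q\<close> has no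
  continuous extension, nothing is known about \<open>L2_extension Q\<close>.\<close>

definition L2_extension ::
    "(('a::euclidean_space \<Rightarrow> complex) \<Rightarrow> ('a \<Rightarrow> complex))
      \<Rightarrow> ('a \<Rightarrow> complex) \<Rightarrow> ('a \<Rightarrow> complex)" where
  "L2_extension Q = (SOME T. is_L2_extension Q T)"

definition qpft ::
    "('n::finite \<Rightarrow> qp_param) \<Rightarrow> (real ^ 'n \<Rightarrow> complex) \<Rightarrow> real ^ 'n \<Rightarrow> complex" where
  "qpft \<Lambda> = L2_extension (qpft_L1 \<Lambda>)"

definition qpft_neg ::
    "('n::finite \<Rightarrow> qp_param) \<Rightarrow> (real ^ 'n \<Rightarrow> complex) \<Rightarrow> real ^ 'n \<Rightarrow> complex" where
  "qpft_neg \<Lambda> = L2_extension (qpft_neg_L1 \<Lambda>)"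

end

theory Submission
  imports Defs "HOL-Probability.Characteristic_Functions"
begin

text \<open>
  The two kernels are complex conjugates of each other, so the backward transform is the formal
  adjoint of the forward one. It is moreover itself a transform of the same family, for the parameter
  with the roles of space and frequency exchanged and all signs flipped
  (\<open>qpft_neg_L1_eq_dual\<close>); hence every estimate for the forward transform \<open>Q\<close> also holds for
  the backward transform \<open>Q'\<close>. A Hilbert space isometry \<open>Q\<close> satisfies \<open>Q* Q = 1\<close>, so the theorem
  amounts to the Plancherel identity \<open>\<parallel>Q f\<parallel> = \<parallel>f\<parallel>\<close>; no pointwise inversion formula is involved.

  Plancherel comes from inserting a Gaussian damping factor into \<open>\<integral>|Q f|\<^sup>2\<close>. The damped integral of
  \<open>K(w,x) cnj (K(w,y))\<close> over \<open>w\<close> is computed coordinate by coordinate: up to unimodular chirps it is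
  the density at \<open>x - y\<close> of a centred normal law with standard deviation \<open>e\<close>
  (\<open>qpft_kernel_reproducing\<close>), the constants \<open>|b\<^sub>k|/2\<pi>\<close> cancelling exactly.
  By Fubini the damped integral of \<open>|Q f|\<^sup>2\<close> is therefore a Gaussian quadratic form in the chirped
  function (\<open>qpft_L1_regularized_parseval\<close>). Schur's test bounds this form by \<open>\<parallel>f\<parallel>\<^sup>2\<close>, and Fatou's
  lemma removes the damping, which gives \<open>\<parallel>Q f\<parallel> \<le> \<parallel>f\<parallel>\<close> on all of \<open>L\<^sup>1 \<inter> L\<^sup>2\<close>
  (\<open>qpft_L1_contraction\<close>). When \<open>f\<close> is continuous with compact support, the Gaussians
  act as an approximate identity and the limit is an equality (\<open>qpft_L1_isometry\<close>).

  The contraction property makes the continuous extensions to \<open>L\<^sup>2\<close> exist, by completeness and by the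
  density of \<open>L\<^sup>1 \<inter> L\<^sup>2\<close> (\<open>is_L2_extension_of_contraction\<close>); so the chosen extensions have their defining
  properties.

  For \<open>f\<close> continuous with compact support, \<open>Q f\<close> need not be integrable and the integral defining
  \<open>Q'\<close> may not apply to it. Its truncations \<open>G\<close> to balls are integrable, and adjointness together
  with the contraction property of \<open>Q'\<close> gives
  \<open>\<parallel>Q' G - f\<parallel>\<^sup>2 = \<parallel>Q' G\<parallel>\<^sup>2 - 2 \<parallel>G\<parallel>\<^sup>2 + \<parallel>f\<parallel>\<^sup>2 \<le> \<parallel>f\<parallel>\<^sup>2 - \<parallel>G\<parallel>\<^sup>2\<close>,
  which tends to \<open>\<parallel>f\<parallel>\<^sup>2 - \<parallel>Q f\<parallel>\<^sup>2 = 0\<close> (\<open>qpft_neg_truncated_tendsto\<close>). Continuity of the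
  extensions and density carry the identity to all of \<open>L\<^sup>2\<close>.
\<close>

section \<open>Square-integrable functions: seminorm, limits, completeness\<close>

lemma L2_spaceD:
  assumes "f \<in> L2_space"
  shows "f \<in> borel_measurable lebesgue" "integrable lebesgue (\<lambda>x. (cmod (f x))\<^sup>2)"
  using assms by (auto simp: L2_space_def)

lemma L2_norm_nonneg: "0 \<le> L2_norm f"
  by (simp add: L2_norm_def)

lemma L2_norm_zero [simp]: "L2_norm (\<lambda>x. 0) = 0"
  by (simp add: L2_norm_def)

lemma L2_norm_power2: "(L2_norm f)\<^sup>2 = (LINT x|lebesgue. (cmod (f x))\<^sup>2)"
  by (simp add: L2_norm_def)

lemma L2_norm_commute: "L2_norm (\<lambda>x. f x - g x) = L2_norm (\<lambda>x. g x - f x)"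
  by (simp add: L2_norm_def norm_minus_commute)

lemma L2_norm_cong_AE:
  assumes "f \<in> borel_measurable lebesgue" "g \<in> borel_measurable lebesgue"
    and "AE x in lebesgue. f x = g x"
  shows "L2_norm f = L2_norm g"
  unfolding L2_norm_def
  by (intro arg_cong[where f=sqrt] integral_cong_AE) (use assms in auto)

lemma L2_space_cong_AE:
  assumes "f \<in> L2_space" "g \<in> borel_measurable lebesgue" "AE x in lebesgue. f x = g x"
  shows "g \<in> L2_space"
proof -
  have "integrable lebesgue (\<lambda>x. (cmod (g x))\<^sup>2)"
    by (rule integrable_cong_AE_imp[OF L2_spaceD(2)[OF assms(1)]]) (use assms in auto)
  with assms show ?thesis by (simp add: L2_space_def)
qed

lemma L2_norm_eq_0:
  assumes "f \<in> L2_space" "L2_norm f = 0"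
  shows "AE x in lebesgue. f x = 0"
proof -
  have "(LINT x|lebesgue. (cmod (f x))\<^sup>2) = 0"
    using assms(2) by (simp add: L2_norm_def)
  then show ?thesis
    using integral_nonneg_eq_0_iff_AE[OF L2_spaceD(2)[OF assms(1)]] by simp
qed

lemma L2_space_dominated:
  fixes w :: "'a::euclidean_space \<Rightarrow> real"
  assumes "integrable lebesgue (\<lambda>x. (w x)\<^sup>2)" "f \<in> borel_measurable lebesgue"
    and "AE x in lebesgue. cmod (f x) \<le> w x"
  shows "f \<in> L2_space"
proof -
  have "AE x in lebesgue. norm ((cmod (f x))\<^sup>2) \<le> norm ((w x)\<^sup>2)"
    using assms(3) by eventually_elim (simp add: power_mono)
  then have "integrable lebesgue (\<lambda>x. (cmod (f x))\<^sup>2)"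
    using assms(2) by (intro Bochner_Integration.integrable_bound[OF assms(1)]) auto
  with assms show ?thesis by (simp add: L2_space_def)
qed

lemma L2_space_add:
  assumes "f \<in> L2_space" "g \<in> L2_space"
  shows "(\<lambda>x. f x + g x) \<in> L2_space"
proof -
  note [measurable] = L2_spaceD(1)[OF assms(1)] L2_spaceD(1)[OF assms(2)]
  have "(cmod (f x + g x))\<^sup>2 \<le> 2 * (cmod (f x))\<^sup>2 + 2 * (cmod (g x))\<^sup>2" for x
  proof -
    have "(cmod (f x + g x))\<^sup>2 \<le> (cmod (f x) + cmod (g x))\<^sup>2"
      by (intro power_mono norm_triangle_ineq) auto
    also have "\<dots> \<le> 2 * (cmod (f x))\<^sup>2 + 2 * (cmod (g x))\<^sup>2"
      using zero_le_power2[of "cmod (f x) - cmod (g x)"] by (simp add: power2_eq_square algebra_simps)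
    finally show ?thesis .
  qed
  then have "AE x in lebesgue. norm ((cmod (f x + g x))\<^sup>2) \<le> norm (2 * (cmod (f x))\<^sup>2 + 2 * (cmod (g x))\<^sup>2)"
    by (intro AE_I2) simp
  moreover have "integrable lebesgue (\<lambda>x. 2 * (cmod (f x))\<^sup>2 + 2 * (cmod (g x))\<^sup>2)"
    using assms[THEN L2_spaceD(2)] by (intro Bochner_Integration.integrable_add integrable_mult_right)
  ultimately have "integrable lebesgue (\<lambda>x. (cmod (f x + g x))\<^sup>2)"
    by (rule Bochner_Integration.integrable_bound[rotated 2]) measurable
  then show ?thesis by (simp add: L2_space_def)
qed

lemma L2_space_minus: "f \<in> L2_space \<Longrightarrow> (\<lambda>x. - f x) \<in> L2_space"
  by (auto simp: L2_space_def)

lemma L2_space_diff: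
  assumes "f \<in> L2_space" "g \<in> L2_space"
  shows "(\<lambda>x. f x - g x) \<in> L2_space"
  using L2_space_add[OF assms(1) L2_space_minus[OF assms(2)]] by simp

text \<open>
  The weighted form of \<open>2ab \<le> a\<^sup>2 + b\<^sup>2\<close> whose integral, with the weights \<open>s\<close> and \<open>t\<close> taken to be the two
  norms, is Minkowski's inequality; this avoids a separate Cauchy-Schwarz inequality for integrals.
\<close>
lemma power2_norm_add_weighted:
  fixes a b :: "'a::real_normed_vector" and s t :: real
  assumes "0 < s" "0 < t"
  shows "(norm (a + b))\<^sup>2 \<le> (s + t) / s * (norm a)\<^sup>2 + (s + t) / t * (norm b)\<^sup>2"
proof -
  have "(norm (a + b))\<^sup>2 \<le> (norm a + norm b)\<^sup>2"
    by (intro power_mono norm_triangle_ineq) auto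
  also have "(norm a + norm b)\<^sup>2 + (t * norm a - s * norm b)\<^sup>2 / (s * t)
      = (s + t) / s * (norm a)\<^sup>2 + (s + t) / t * (norm b)\<^sup>2"
    using assms by (simp add: field_simps power2_eq_square)
  then have "(norm a + norm b)\<^sup>2 \<le> (s + t) / s * (norm a)\<^sup>2 + (s + t) / t * (norm b)\<^sup>2"
    using assms by (smt (verit) zero_le_divide_iff zero_le_power2 mult_pos_pos)
  finally show ?thesis .
qed

lemma L2_norm_triangle:
  assumes f: "f \<in> L2_space" and g: "g \<in> L2_space"
  shows "L2_norm (\<lambda>x. f x + g x) \<le> L2_norm f + L2_norm g"
proof (rule field_le_epsilon)
  fix e :: real assume "0 < e"
  \<comment> \<open>a positive slack, since the weights must not vanish when a norm does\<close>
  define s where "s = L2_norm f + e / 2"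
  define t where "t = L2_norm g + e / 2"
  have st: "0 < s" "0 < t" "L2_norm f \<le> s" "L2_norm g \<le> t"
    using \<open>0 < e\<close> L2_norm_nonneg[of f] L2_norm_nonneg[of g] by (auto simp: s_def t_def)
  have "(L2_norm (\<lambda>x. f x + g x))\<^sup>2
      \<le> (LINT x|lebesgue. (s + t) / s * (cmod (f x))\<^sup>2 + (s + t) / t * (cmod (g x))\<^sup>2)"
    unfolding L2_norm_power2
    using L2_spaceD(2)[OF L2_space_add[OF f g]] L2_spaceD(2)[OF f] L2_spaceD(2)[OF g]
      power2_norm_add_weighted[OF st(1,2)]
    by (intro integral_mono) auto
  also have "\<dots> = (s + t) / s * (L2_norm f)\<^sup>2 + (s + t) / t * (L2_norm g)\<^sup>2"
    using L2_spaceD(2)[OF f] L2_spaceD(2)[OF g]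
    by (subst Bochner_Integration.integral_add) (auto simp: L2_norm_power2)
  also have "\<dots> \<le> (s + t) / s * s\<^sup>2 + (s + t) / t * t\<^sup>2"
    using st L2_norm_nonneg by (intro add_mono mult_left_mono power_mono) auto
  also have "\<dots> = (s + t)\<^sup>2"
    using st by (simp add: field_simps power2_eq_square)
  finally have "L2_norm (\<lambda>x. f x + g x) \<le> s + t"
    by (rule power2_le_imp_le) (use st in auto)
  then show "L2_norm (\<lambda>x. f x + g x) \<le> L2_norm f + L2_norm g + e"
    by (simp add: s_def t_def)
qed

lemma L2_norm_diff_triangle:
  assumes "f \<in> L2_space" "g \<in> L2_space" "h \<in> L2_space"
  shows "L2_norm (\<lambda>x. f x - h x) \<le> L2_norm (\<lambda>x. f x - g x) + L2_norm (\<lambda>x. g x - h x)"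
  using L2_norm_triangle[OF L2_space_diff[OF assms(1,2)] L2_space_diff[OF assms(2,3)]] by simp

lemma L2_AE_eqI:
  assumes "f \<in> L2_space" "g \<in> L2_space" "\<And>e. 0 < e \<Longrightarrow> L2_norm (\<lambda>x. f x - g x) < e"
  shows "AE x in lebesgue. f x = g x"
proof -
  have "L2_norm (\<lambda>x. f x - g x) = 0"
    using assms(3)[of "L2_norm (\<lambda>x. f x - g x)"] L2_norm_nonneg[of "\<lambda>x. f x - g x"] by linarith
  from L2_norm_eq_0[OF L2_space_diff[OF assms(1,2)] this]
  show ?thesis by eventually_elim simp
qed

text \<open>
  The unit balls of \<open>L\<^sup>2\<close> are closed under almost everywhere convergence. Below this identifies limits of
  Cauchy sequences and removes the Gaussian damping.
\<close>
lemma L2_fatou: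
  assumes F: "\<And>n. F n \<in> L2_space" and bound: "eventually (\<lambda>n. L2_norm (F n) \<le> C) sequentially"
    and lim: "AE x in lebesgue. (\<lambda>n. F n x) \<longlonglongrightarrow> f x"
    and f[measurable]: "f \<in> borel_measurable lebesgue"
  shows "f \<in> L2_space" "L2_norm f \<le> C"
proof -
  note [measurable] = L2_spaceD(1)[OF F]
  have "0 \<le> C"
  proof -
    obtain n where "L2_norm (F n) \<le> C"
      using eventually_happens[OF bound] by auto
    then show ?thesis using L2_norm_nonneg[of "F n"] by linarith
  qed
  have nn: "(\<integral>\<^sup>+x. ennreal ((cmod (F n x))\<^sup>2) \<partial>lebesgue) = ennreal ((L2_norm (F n))\<^sup>2)" for n
    using L2_spaceD(2)[OF F] by (simp add: nn_integral_eq_integral L2_norm_power2)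
  have "(\<integral>\<^sup>+x. ennreal ((cmod (f x))\<^sup>2) \<partial>lebesgue)
      = (\<integral>\<^sup>+x. liminf (\<lambda>n. ennreal ((cmod (F n x))\<^sup>2)) \<partial>lebesgue)"
  proof (rule nn_integral_cong_AE, use lim in eventually_elim)
    fix x assume "(\<lambda>n. F n x) \<longlonglongrightarrow> f x"
    then have "(\<lambda>n. ennreal ((cmod (F n x))\<^sup>2)) \<longlonglongrightarrow> ennreal ((cmod (f x))\<^sup>2)"
      by (intro tendsto_intros)
    then show "ennreal ((cmod (f x))\<^sup>2) = liminf (\<lambda>n. ennreal ((cmod (F n x))\<^sup>2))"
      by (rule lim_imp_Liminf[OF trivial_limit_sequentially, symmetric])
  qed
  also have "\<dots> \<le> liminf (\<lambda>n. \<integral>\<^sup>+x. ennreal ((cmod (F n x))\<^sup>2) \<partial>lebesgue)"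
    by (rule nn_integral_liminf) auto
  also have "\<dots> \<le> ennreal (C\<^sup>2)"
    unfolding nn
    by (rule order.trans[OF Liminf_le_Limsup[OF trivial_limit_sequentially] Limsup_bounded],
        rule eventually_mono[OF bound])
       (intro ennreal_leI power_mono L2_norm_nonneg)
  finally have le: "(\<integral>\<^sup>+x. ennreal ((cmod (f x))\<^sup>2) \<partial>lebesgue) \<le> ennreal (C\<^sup>2)" .
  then have int: "integrable lebesgue (\<lambda>x. (cmod (f x))\<^sup>2)"
    by (intro integrableI_bounded) (auto intro: le_less_trans)
  then show "f \<in> L2_space"
    by (simp add: L2_space_def)
  have "(L2_norm f)\<^sup>2 \<le> C\<^sup>2"
    using le int by (simp add: nn_integral_eq_integral L2_norm_power2)
  then show "L2_norm f \<le> C"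
    by (rule power2_le_imp_le) fact
qed

lemma L2_dominated_convergence:
  fixes w :: "'a::euclidean_space \<Rightarrow> real"
  assumes w: "integrable lebesgue (\<lambda>x. (w x)\<^sup>2)" 
    and [measurable]: "\<And>n. F n \<in> borel_measurable lebesgue" "f \<in> borel_measurable lebesgue"
    and lim: "AE x in lebesgue. (\<lambda>n. F n x) \<longlonglongrightarrow> f x"
    and bound: "\<And>n. AE x in lebesgue. cmod (F n x) \<le> w x"
  shows "(\<lambda>n. L2_norm (\<lambda>x. F n x - f x)) \<longlonglongrightarrow> 0"
proof -
  have bound': "AE x in lebesgue. \<forall>n. cmod (F n x) \<le> w x"
    using bound by (simp add: AE_all_countable)
  have "(\<lambda>n. LINT x|lebesgue. (cmod (F n x - f x))\<^sup>2) \<longlonglongrightarrow> (LINT x::'a|lebesgue. (0::real))"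
  proof (rule integral_dominated_convergence[where w="\<lambda>x::'a. 4 * (w x)\<^sup>2"])
    show "AE x in lebesgue. (\<lambda>n. (cmod (F n x - f x))\<^sup>2) \<longlonglongrightarrow> 0"
      using lim by eventually_elim (auto intro!: tendsto_eq_intros)
    fix n
    show "AE x in lebesgue. norm ((cmod (F n x - f x))\<^sup>2) \<le> 4 * (w x)\<^sup>2"
      using lim bound'
    proof eventually_elim
      fix x assume lim: "(\<lambda>n. F n x) \<longlonglongrightarrow> f x" and b: "\<forall>n. cmod (F n x) \<le> w x"
      have "cmod (f x) \<le> w x"
        by (rule LIMSEQ_le_const2[OF tendsto_norm[OF lim]]) (use b in auto)
      then have "cmod (F n x - f x) \<le> 2 * w x"
        using norm_triangle_ineq4[of "F n x" "f x"] b[rule_format, of n] by linarith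
      then have "(cmod (F n x - f x))\<^sup>2 \<le> (2 * w x)\<^sup>2"
        by (intro power_mono) auto
      then show "norm ((cmod (F n x - f x))\<^sup>2) \<le> 4 * (w x)\<^sup>2"
        by (simp add: power_mult_distrib)
    qed
  qed (use w in auto)
  then show ?thesis
    unfolding L2_norm_def by (auto intro: tendsto_eq_intros)
qed

text \<open>
  Riesz-Fischer for sequences with geometrically small steps \<open>h n\<close>. The sum of \<open>2^n |h n|\<^sup>2\<close> has a finite
  integral, so it converges almost everywhere; since \<open>2 |h n| \<le> 2^-n + 2^n |h n|\<^sup>2\<close>, so does the telescoping
  series. Fatou's lemma upgrades this pointwise limit to a limit in norm.
\<close>
lemma L2_complete:
  fixes G :: "nat \<Rightarrow> 'a::euclidean_space \<Rightarrow> complex"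
  assumes G: "\<And>n. G n \<in> L2_space"
    and bound: "\<And>n. L2_norm (\<lambda>x. G (Suc n) x - G n x) \<le> (1/2)^n"
  obtains g where "g \<in> L2_space" "(\<lambda>n. L2_norm (\<lambda>x. G n x - g x)) \<longlonglongrightarrow> 0"
proof -
  note [measurable] = L2_spaceD(1)[OF G]
  define h where "h = (\<lambda>n x. G (Suc n) x - G n x)"
  have h: "h n \<in> L2_space" for n
    unfolding h_def by (intro L2_space_diff G)
  note [measurable] = L2_spaceD(1)[OF h]
  have le: "(\<integral>\<^sup>+x. ennreal (2^n * (cmod (h n x))\<^sup>2) \<partial>lebesgue) \<le> ennreal ((1/2)^n)" for n
  proof -
    have "(\<integral>\<^sup>+x. ennreal (2^n * (cmod (h n x))\<^sup>2) \<partial>lebesgue) = ennreal (2^n * (L2_norm (h n))\<^sup>2)"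
      using L2_spaceD(2)[OF h] by (subst nn_integral_eq_integral) (auto simp: L2_norm_power2)
    also have "\<dots> \<le> ennreal (2^n * ((1/2)^n)\<^sup>2)"
      using bound[of n] by (intro ennreal_leI mult_left_mono power_mono L2_norm_nonneg) (auto simp: h_def)
    also have "2^n * ((1/2)^n)\<^sup>2 = (1/2::real)^n"
      by (simp add: power2_eq_square power_divide)
    finally show ?thesis .
  qed
  have "(\<integral>\<^sup>+x. (\<Sum>n. ennreal (2^n * (cmod (h n x))\<^sup>2)) \<partial>lebesgue)
      = (\<Sum>n. \<integral>\<^sup>+x. ennreal (2^n * (cmod (h n x))\<^sup>2) \<partial>lebesgue)"
    by (rule nn_integral_suminf) auto
  also have "\<dots> \<le> (\<Sum>n. ennreal ((1/2)^n))"
    by (intro suminf_le le) auto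
  also have "\<dots> < \<infinity>"
    by (subst suminf_ennreal2) (auto simp: summable_geometric)
  finally have "(\<integral>\<^sup>+x. (\<Sum>n. ennreal (2^n * (cmod (h n x))\<^sup>2)) \<partial>lebesgue) \<noteq> \<infinity>"
    by simp
  then have "AE x in lebesgue. (\<Sum>n. ennreal (2^n * (cmod (h n x))\<^sup>2)) \<noteq> \<infinity>"
    by (rule nn_integral_PInf_AE[rotated]) auto
  then have lim: "AE x in lebesgue. (\<lambda>n. G n x) \<longlonglongrightarrow> lim (\<lambda>n. G n x)"
  proof eventually_elim
    fix x assume "(\<Sum>n. ennreal (2^n * (cmod (h n x))\<^sup>2)) \<noteq> \<infinity>"
    then have "summable (\<lambda>n. 2^n * (cmod (h n x))\<^sup>2)"
      by (intro summable_suminf_not_top) auto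
    then have "summable (\<lambda>n. (1/2)^n + 2^n * (cmod (h n x))\<^sup>2)"
      by (intro summable_add) (auto simp: summable_geometric)
    then have "summable (\<lambda>n. h n x)"
    proof (rule summable_comparison_test'[where N=0])
      fix n
      \<comment> \<open>arithmetic-geometric mean inequality for \<open>2\<^sup>-\<^sup>n\<close> and \<open>2\<^sup>n |h\<^sub>n|\<^sup>2\<close>\<close>
      have "0 \<le> (1/2::real)^n * (1 - 2^n * cmod (h n x))\<^sup>2" by simp
      also have "\<dots> = (1/2)^n + 2^n * (cmod (h n x))\<^sup>2 - 2 * cmod (h n x)"
        by (simp add: power2_eq_square algebra_simps power_one_over)
      finally show "norm (h n x) \<le> (1/2)^n + 2^n * (cmod (h n x))\<^sup>2"
        using norm_ge_zero[of "h n x"] by linarith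
    qed
    then have "(\<lambda>n. \<Sum>i<n. h i x) \<longlonglongrightarrow> (\<Sum>n. h n x)"
      by (rule summable_LIMSEQ)
    then have "(\<lambda>n. (\<Sum>i<n. h i x) + G 0 x) \<longlonglongrightarrow> (\<Sum>n. h n x) + G 0 x"
      by (intro tendsto_intros)
    moreover have "(\<Sum>i<n. h i x) + G 0 x = G n x" for n
      unfolding h_def by (induction n) (simp_all add: algebra_simps)
    ultimately show "(\<lambda>n. G n x) \<longlonglongrightarrow> lim (\<lambda>n. G n x)"
      by (simp add: convergent_LIMSEQ_iff[symmetric] convergentI)
  qed
  define g where "g x = lim (\<lambda>n. G n x)" for x
  have [measurable]: "g \<in> borel_measurable lebesgue"
    unfolding g_def by measurable
  have tail: "L2_norm (\<lambda>x. G (n + k) x - G n x) \<le> 2 * (1/2)^n * (1 - (1/2)^k)" for n k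
  proof (induction k)
    case 0 then show ?case by (simp add: L2_norm_def)
  next
    case (Suc k)
    have "L2_norm (\<lambda>x. G (n + Suc k) x - G n x)
        \<le> L2_norm (\<lambda>x. G (Suc (n + k)) x - G (n + k) x) + L2_norm (\<lambda>x. G (n + k) x - G n x)"
      using L2_norm_diff_triangle[OF G G G, of "Suc (n+k)" n "n+k"] by simp
    also have "\<dots> \<le> (1/2)^(n + k) + 2 * (1/2)^n * (1 - (1/2)^k)"
      by (intro add_mono bound Suc)
    also have "\<dots> = 2 * (1/2)^n * (1 - (1/2)^Suc k)"
      by (simp add: algebra_simps power_add)
    finally show ?case .
  qed
  have ev: "eventually (\<lambda>m. L2_norm (\<lambda>x. G m x - G n x) \<le> 2 * (1/2)^n) sequentially" for n
  proof (rule eventually_sequentiallyI[of n])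
    fix m assume "n \<le> m"
    have "2 * (1/2)^n * (1 - (1/2)^(m - n)) \<le> 2 * (1/2::real)^n * 1"
      by (intro mult_left_mono) auto
    moreover have "L2_norm (\<lambda>x. G m x - G n x) \<le> 2 * (1/2)^n * (1 - (1/2)^(m - n))"
      using tail[of n "m - n"] \<open>n \<le> m\<close> by simp
    ultimately show "L2_norm (\<lambda>x. G m x - G n x) \<le> 2 * (1/2)^n"
      by linarith
  qed
  have limg: "AE x in lebesgue. (\<lambda>m. G m x - G n x) \<longlonglongrightarrow> g x - G n x" for n
    using lim by eventually_elim (auto simp: g_def intro!: tendsto_intros)
  have diff: "(\<lambda>x. g x - G n x) \<in> L2_space" "L2_norm (\<lambda>x. g x - G n x) \<le> 2 * (1/2)^n" for n
    using L2_fatou[OF L2_space_diff[OF G G] ev limg] by auto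
  show ?thesis
  proof
    show "g \<in> L2_space"
      using L2_space_add[OF diff(1)[of 0] G[of 0]] by simp
    have "(\<lambda>n. (1/2)^n :: real) \<longlonglongrightarrow> 0"
      by (rule LIMSEQ_power_zero) simp
    then have "(\<lambda>n. 2 * (1/2)^n :: real) \<longlonglongrightarrow> 0"
      by (rule tendsto_mult_right_zero)
    moreover have "norm (L2_norm (\<lambda>x. G n x - g x)) \<le> 2 * (1/2)^n" for n
      using diff(2)[of n] L2_norm_commute[of "G n" g] L2_norm_nonneg[of "\<lambda>x. G n x - g x"]
      by (metis abs_of_nonneg real_norm_def)
    ultimately show "(\<lambda>n. L2_norm (\<lambda>x. G n x - g x)) \<longlonglongrightarrow> 0"
      by (rule Lim_null_comparison[OF always_eventually[OF allI], rotated])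
  qed
qed

section \<open>Density of continuous functions with compact support\<close>

definition continuous_compact_support :: "('a::euclidean_space \<Rightarrow> complex) \<Rightarrow> bool" where
  "continuous_compact_support f \<longleftrightarrow> continuous_on UNIV f \<and> (\<exists>R. \<forall>x. R < norm x \<longrightarrow> f x = 0)"

lemma integrable_lebesgue_ball_indicator:
  "integrable lebesgue (\<lambda>x::'a::euclidean_space. c * indicat_real (cball 0 R) x)"
proof -
  have "integrable lborel (\<lambda>x::'a. c * indicat_real (cball 0 R) x)"
    by (intro integrable_mult_right integrable_real_indicator) (simp_all add: emeasure_lborel_cball_finite[unfolded infinity_ennreal_def])
  then show ?thesis
    by (subst integrable_completion) auto
qed

lemma integrable_lebesgue_ball_indicator_power2:
  "integrable lebesgue (\<lambda>x::'a::euclidean_space. (c * indicat_real (cball 0 R) x)\<^sup>2)"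
proof -
  have "(c * indicat_real (cball 0 R) x)\<^sup>2 = c\<^sup>2 * indicat_real (cball 0 R) x" for x :: 'a
    by (simp add: indicator_def)
  then show ?thesis
    using integrable_lebesgue_ball_indicator[of "c\<^sup>2" R] by simp
qed

lemma bounded_support_integrable_L2:
  assumes [measurable]: "f \<in> borel_measurable lebesgue"
    and bound: "\<And>x. cmod (f x) \<le> B" and supp: "\<And>x. R < norm x \<Longrightarrow> f x = 0"
  shows "integrable lebesgue f" "f \<in> L2_space"
proof -
  have b: "cmod (f x) \<le> B * indicat_real (cball 0 R) x" for x
    using bound[of x] supp[of x] by (auto simp: indicator_def not_le)
  then have ae: "AE x in lebesgue. cmod (f x) \<le> B * indicat_real (cball 0 R) x"
    by simp
  have "AE x in lebesgue. norm (f x) \<le> norm (B * indicat_real (cball 0 R) x)"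
    using order_trans[OF b abs_ge_self] by (simp only: real_norm_def AE_I2)
  then show "integrable lebesgue f"
    by (intro Bochner_Integration.integrable_bound[OF integrable_lebesgue_ball_indicator]) auto
  show "f \<in> L2_space"
    by (rule L2_space_dominated[OF integrable_lebesgue_ball_indicator_power2 assms(1) ae])
qed

lemma continuous_compact_supportD:
  assumes "continuous_compact_support f"
  shows "continuous_on UNIV f" "f \<in> borel_measurable borel" "integrable lebesgue f" "f \<in> L2_space"
    "\<exists>B. \<forall>x. cmod (f x) \<le> B"
proof -
  obtain R where c: "continuous_on UNIV f" and R: "\<And>x. R < norm x \<Longrightarrow> f x = 0"
    using assms by (auto simp: continuous_compact_support_def)
  show "continuous_on UNIV f" by fact
  show m: "f \<in> borel_measurable borel"
    using c by (rule borel_measurable_continuous_onI)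
  have "bounded (f ` cball 0 R)"
    by (intro compact_imp_bounded compact_continuous_image continuous_on_subset[OF c]) auto
  then obtain B where "\<forall>x\<in>cball 0 R. cmod (f x) \<le> B"
    by (auto simp: bounded_iff)
  then have "norm x \<le> R \<Longrightarrow> cmod (f x) \<le> B" for x
    by simp
  then have B: "cmod (f x) \<le> max B 0" for x
    using R[of x] by (cases "norm x \<le> R") (auto simp: le_max_iff_disj)
  then show "\<exists>B. \<forall>x. cmod (f x) \<le> B" by blast
  have ml: "f \<in> borel_measurable lebesgue"
    using m by (simp add: measurable_completion)
  show "integrable lebesgue f" "f \<in> L2_space"
    using bounded_support_integrable_L2[OF ml B R] by auto
qed

definition clamp_norm :: "real \<Rightarrow> complex \<Rightarrow> complex" where
  "clamp_norm B z = (B / max B (cmod z)) *\<^sub>R z"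

lemma clamp_norm:
  assumes "0 < B"
  shows "cmod (clamp_norm B z) \<le> B" "cmod z \<le> B \<Longrightarrow> clamp_norm B z = z"
    "continuous_on UNIV (clamp_norm B)"
proof -
  have "B * cmod z \<le> B * max B (cmod z)"
    using assms by (intro mult_left_mono) auto
  then show "cmod (clamp_norm B z) \<le> B"
    using assms by (simp add: clamp_norm_def divide_le_eq less_max_iff_disj)
  show "cmod z \<le> B \<Longrightarrow> clamp_norm B z = z"
    using assms by (simp add: clamp_norm_def max_def)
  show "continuous_on UNIV (clamp_norm B)"
    unfolding clamp_norm_def using assms
    by (intro continuous_intros) (auto simp: max_def)
qed

text \<open>
  The continuous functions found here carry no common bound, which is why the next lemma clamps them.
\<close>
lemma lebesgue_measurable_imp_limit_continuous:
  fixes f :: "'a::euclidean_space \<Rightarrow> complex"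
  assumes "f \<in> borel_measurable lebesgue"
  obtains h where "\<And>n. continuous_on UNIV (h n)" "AE x in lebesgue. (\<lambda>n. h n x) \<longlonglongrightarrow> f x"
proof -
  have "f measurable_on UNIV"
    using lebesgue_measurable_imp_measurable_on[of f UNIV] assms by simp
  then obtain N g where N: "negligible N" and g: "\<And>n. continuous_on UNIV (g n)"
    and lim: "\<And>x. x \<notin> N \<Longrightarrow> (\<lambda>n. g n x) \<longlonglongrightarrow> f x"
    by (auto simp: measurable_on_def)
  have "AE x in lebesgue. (\<lambda>n. g n x) \<longlonglongrightarrow> f x"
    by (rule AE_I'[of N]) (use N lim in \<open>auto simp: negligible_iff_null_sets\<close>)
  with g that show ?thesis by blast
qed

text \<open>
  Clamping continuous approximants to the bound of \<open>f\<close> and multiplying them by a continuous cutoff keeps them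
  convergent to \<open>f\<close> and gives them a common square-integrable majorant, so that dominated convergence applies.
\<close>
lemma bounded_supported_approx:
  assumes f[measurable]: "f \<in> borel_measurable lebesgue"
    and bound: "\<And>x. cmod (f x) \<le> B" and supp: "\<And>x. R < norm x \<Longrightarrow> f x = 0" and "0 < e"
  obtains g where "continuous_compact_support g" "L2_norm (\<lambda>x. g x - f x) < e"
proof -
  define C where "C = max B 1"
  have C: "0 < C" "\<And>x. cmod (f x) \<le> C"
    using bound by (auto simp: C_def le_max_iff_disj)
  obtain h where h: "\<And>n. continuous_on UNIV (h n)" "AE x in lebesgue. (\<lambda>n. h n x) \<longlonglongrightarrow> f x"
    using lebesgue_measurable_imp_limit_continuous[OF f] by blast
  define cut where "cut x = max 0 (min 1 (R + 1 - norm x))" for x :: 'a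
  have cut: "0 \<le> cut x" "cut x \<le> 1" "R + 1 < norm x \<Longrightarrow> cut x = 0" "norm x \<le> R \<Longrightarrow> cut x = 1" for x
    by (auto simp: cut_def)
  have cut_cont: "continuous_on UNIV cut"
    unfolding cut_def by (intro continuous_intros)
  define g where "g n x = cut x *\<^sub>R clamp_norm C (h n x)" for n x
  have g_cont: "continuous_on UNIV (g n)" for n
    unfolding g_def
    by (intro continuous_on_scaleR cut_cont continuous_on_compose2[OF clamp_norm(3)[OF C(1)] h(1)]) auto
  have g_supp: "R + 1 < norm x \<Longrightarrow> g n x = 0" for n x
    using cut(3) by (simp add: g_def)
  have g: "continuous_compact_support (g n)" for n
    using g_cont g_supp by (auto simp: continuous_compact_support_def)
  have g_bound: "cmod (g n x) \<le> C * indicat_real (cball 0 (R + 1)) x" for n x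
  proof -
    have "cut x * cmod (clamp_norm C (h n x)) \<le> 1 * C"
      by (intro mult_mono cut clamp_norm C) auto
    then show ?thesis
      using g_supp[of x n] cut(1)[of x] by (auto simp: g_def indicator_def not_le)
  qed
  have "(\<lambda>n. L2_norm (\<lambda>x. g n x - f x)) \<longlonglongrightarrow> 0"
  proof (rule L2_dominated_convergence)
    show "integrable lebesgue (\<lambda>x. (C * indicat_real (cball (0::'a) (R + 1)) x)\<^sup>2)"
      by (rule integrable_lebesgue_ball_indicator_power2)
    show "g n \<in> borel_measurable lebesgue" for n
      by (rule L2_spaceD(1)[OF continuous_compact_supportD(4)[OF g]])
    show "AE x in lebesgue. (\<lambda>n. g n x) \<longlonglongrightarrow> f x"
      using h(2)
    proof eventually_elim
      fix x assume "(\<lambda>n. h n x) \<longlonglongrightarrow> f x"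
      then have "(\<lambda>n. clamp_norm C (h n x)) \<longlonglongrightarrow> clamp_norm C (f x)"
        by (rule continuous_on_tendsto_compose[OF clamp_norm(3)[OF C(1)]]) auto
      then have "(\<lambda>n. g n x) \<longlonglongrightarrow> cut x *\<^sub>R f x"
        unfolding g_def clamp_norm(2)[OF C(1) C(2)] by (intro tendsto_intros)
      moreover have "cut x *\<^sub>R f x = f x"
        using supp[of x] cut(4)[of x] by (cases "norm x \<le> R") auto
      ultimately show "(\<lambda>n. g n x) \<longlonglongrightarrow> f x" by simp
    qed
    show "AE x in lebesgue. cmod (g n x) \<le> C * indicat_real (cball 0 (R + 1)) x" for n
      using g_bound by simp
  qed fact
  from order_tendstoD(2)[OF this \<open>0 < e\<close>] obtain n where "L2_norm (\<lambda>x. g n x - f x) < e"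
    by (auto dest: eventually_happens)
  with g that show ?thesis by blast
qed

text \<open>
  Truncating \<open>f\<close> both in size and in space reduces the claim to bounded functions with bounded support.
\<close>
lemma continuous_compact_support_dense:
  assumes f: "f \<in> L2_space" and "0 < e"
  obtains g where "continuous_compact_support g" "L2_norm (\<lambda>x. g x - f x) < e"
proof -
  note [measurable] = L2_spaceD(1)[OF f]
  define F where "F n x = (if norm x \<le> real n \<and> cmod (f x) \<le> real n then f x else 0)" for n x
  have F_meas[measurable]: "F n \<in> borel_measurable lebesgue" for n
  proof -
    have "(\<lambda>x. indicat_real (cball 0 (real n)) x *\<^sub>R (if cmod (f x) \<le> real n then f x else 0))
        \<in> borel_measurable lebesgue"
      by (intro borel_measurable_scaleR borel_measurable_indicator) auto
    also have "(\<lambda>x. indicat_real (cball 0 (real n)) x *\<^sub>R (if cmod (f x) \<le> real n then f x else 0)) = F n"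
      by (auto simp: F_def indicator_def)
    finally show ?thesis .
  qed
  have F_bound: "cmod (F n x) \<le> real n" "real n < norm x \<Longrightarrow> F n x = 0" for n x
    by (auto simp: F_def)
  have "(\<lambda>n. L2_norm (\<lambda>x. F n x - f x)) \<longlonglongrightarrow> 0"
  proof (rule L2_dominated_convergence[OF L2_spaceD(2)[OF f]])
    show "AE x in lebesgue. (\<lambda>n. F n x) \<longlonglongrightarrow> f x"
    proof (intro AE_I2 tendsto_eventually eventually_sequentiallyI)
      fix x n assume "nat \<lceil>max (norm x) (cmod (f x))\<rceil> \<le> n"
      then show "F n x = f x"
        by (auto simp: F_def nat_le_iff ceiling_le_iff)
    qed
  qed (rule F_meas, measurable, auto simp: F_def)
  from order_tendstoD(2)[OF this, of "e / 2"] \<open>0 < e\<close>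
  obtain n where n: "L2_norm (\<lambda>x. F n x - f x) < e / 2"
    by (auto dest: eventually_happens)
  obtain g where g: "continuous_compact_support g" "L2_norm (\<lambda>x. g x - F n x) < e / 2"
    using bounded_supported_approx[of "F n" "real n" "real n" "e / 2"] F_bound \<open>0 < e\<close> by auto
  have "F n \<in> L2_space"
    using bounded_support_integrable_L2(2)[of "F n" "real n" "real n"] F_bound by auto
  from L2_norm_diff_triangle[OF continuous_compact_supportD(4)[OF g(1)] this f]
  have "L2_norm (\<lambda>x. g x - f x) < e"
    using n g(2) by linarith
  with g(1) that show ?thesis by blast
qed

section \<open>Continuous extension of a contraction\<close>

lemma is_L2_extensionD:
  assumes "is_L2_extension Q T"
  shows "f \<in> L2_space \<Longrightarrow> T f \<in> L2_space"
    and "f \<in> L2_space \<Longrightarrow> integrable lebesgue f \<Longrightarrow> AE x in lebesgue. T f x = Q f x"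
    and "f \<in> L2_space \<Longrightarrow> 0 < e \<Longrightarrow> \<exists>d>0. \<forall>g\<in>L2_space. L2_norm (\<lambda>x. g x - f x) < d \<longrightarrow> L2_norm (\<lambda>x. T g x - T f x) < e"
  using assms by (auto simp: is_L2_extension_def)

text \<open>
  The value at \<open>f\<close> is any \<open>g\<close> with \<open>\<parallel>Q h - g\<parallel> \<le> \<parallel>h - f\<parallel>\<close> for all \<open>h\<close> in \<open>L\<^sup>1 \<inter> L\<^sup>2\<close>. Such a \<open>g\<close> is the limit
  of \<open>Q h\<close> along a fast sequence \<open>h\<close> converging to \<open>f\<close>, and this one property yields both agreement with
  \<open>Q\<close> (take \<open>h = f\<close>) and continuity (compare two values through a common \<open>h\<close>). The statement is about the
  chosen operator \<open>L2_extension Q\<close>, about which nothing would be known otherwise.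
\<close>
lemma is_L2_extension_of_contraction:
  fixes Q :: "('a::euclidean_space \<Rightarrow> complex) \<Rightarrow> 'a \<Rightarrow> complex"
  assumes maps: "\<And>f. f \<in> L2_space \<Longrightarrow> integrable lebesgue f \<Longrightarrow> Q f \<in> L2_space"
    and contr: "\<And>f g. f \<in> L2_space \<Longrightarrow> integrable lebesgue f \<Longrightarrow> g \<in> L2_space \<Longrightarrow> integrable lebesgue g
      \<Longrightarrow> L2_norm (\<lambda>x. Q f x - Q g x) \<le> L2_norm (\<lambda>x. f x - g x)"
  shows "is_L2_extension Q (L2_extension Q)"
proof -
  define D :: "('a \<Rightarrow> complex) set" where "D = {h \<in> L2_space. integrable lebesgue h}"
  define P where "P f g \<longleftrightarrow> g \<in> L2_space \<and> (\<forall>h\<in>D. L2_norm (\<lambda>x. Q h x - g x) \<le> L2_norm (\<lambda>x. h x - f x))"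
    for f g
  have D: "h \<in> L2_space" "Q h \<in> L2_space" if "h \<in> D" for h
    using that maps by (auto simp: D_def)
  have contrD: "L2_norm (\<lambda>x. Q f x - Q g x) \<le> L2_norm (\<lambda>x. f x - g x)" if "f \<in> D" "g \<in> D" for f g
    using that contr by (auto simp: D_def)
  have dense: "\<exists>h\<in>D. L2_norm (\<lambda>x. h x - f x) < e" if "f \<in> L2_space" "0 < e" for f e
  proof -
    obtain h where "continuous_compact_support h" "L2_norm (\<lambda>x. h x - f x) < e"
      using continuous_compact_support_dense[OF \<open>f \<in> L2_space\<close> \<open>0 < e\<close>] .
    then show ?thesis
      using continuous_compact_supportD(3,4)[of h] by (auto simp: D_def)
  qed
  have "\<exists>g. P f g" if f: "f \<in> L2_space" for f
  proof -
    have "\<exists>h\<in>D. L2_norm (\<lambda>x. h x - f x) < (1/2)^n / 2" for n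
      by (rule dense[OF f]) simp
    then obtain h where h: "\<And>n. h n \<in> D" "\<And>n. L2_norm (\<lambda>x. h n x - f x) < (1/2)^n / 2"
      by metis
    have step: "L2_norm (\<lambda>x. Q (h (Suc n)) x - Q (h n) x) \<le> (1/2)^n" for n
    proof -
      have "L2_norm (\<lambda>x. Q (h (Suc n)) x - Q (h n) x) \<le> L2_norm (\<lambda>x. h (Suc n) x - h n x)"
        by (intro contrD h)
      also have "\<dots> \<le> L2_norm (\<lambda>x. h (Suc n) x - f x) + L2_norm (\<lambda>x. f x - h n x)"
        by (intro L2_norm_diff_triangle D h f)
      also have "L2_norm (\<lambda>x. f x - h n x) = L2_norm (\<lambda>x. h n x - f x)"
        by (rule L2_norm_commute)
      also have "L2_norm (\<lambda>x. h (Suc n) x - f x) + \<dots> \<le> (1/2)^Suc n / 2 + (1/2)^n / 2"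
        by (intro add_mono less_imp_le h)
      also have "\<dots> \<le> (1/2)^n" by simp
      finally show ?thesis .
    qed
    obtain g where g: "g \<in> L2_space" "(\<lambda>n. L2_norm (\<lambda>x. Q (h n) x - g x)) \<longlonglongrightarrow> 0"
      using L2_complete[OF D(2)[OF h(1)] step] .
    have "L2_norm (\<lambda>x. Q k x - g x) \<le> L2_norm (\<lambda>x. k x - f x)" if k: "k \<in> D" for k
    proof (rule LIMSEQ_le_const)
      have "(\<lambda>n. (1/2)^n / 2 :: real) \<longlonglongrightarrow> 0 / 2"
        by (intro tendsto_intros LIMSEQ_power_zero) auto
      from tendsto_add[OF tendsto_add[OF tendsto_const this] g(2), of "L2_norm (\<lambda>x. k x - f x)"]
      show "(\<lambda>n. L2_norm (\<lambda>x. k x - f x) + (1/2)^n / 2 + L2_norm (\<lambda>x. Q (h n) x - g x))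
          \<longlonglongrightarrow> L2_norm (\<lambda>x. k x - f x)"
        by simp
      show "\<exists>N. \<forall>n\<ge>N. L2_norm (\<lambda>x. Q k x - g x)
          \<le> L2_norm (\<lambda>x. k x - f x) + (1/2)^n / 2 + L2_norm (\<lambda>x. Q (h n) x - g x)"
      proof (intro exI allI impI)
        fix n
        have "L2_norm (\<lambda>x. Q k x - g x)
            \<le> L2_norm (\<lambda>x. Q k x - Q (h n) x) + L2_norm (\<lambda>x. Q (h n) x - g x)"
          by (intro L2_norm_diff_triangle D h k g)
        moreover have "L2_norm (\<lambda>x. Q k x - Q (h n) x) \<le> L2_norm (\<lambda>x. k x - h n x)"
          by (intro contrD h k)
        moreover have "L2_norm (\<lambda>x. k x - h n x) \<le> L2_norm (\<lambda>x. k x - f x) + L2_norm (\<lambda>x. f x - h n x)"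
          by (intro L2_norm_diff_triangle D h k f)
        moreover have "L2_norm (\<lambda>x. f x - h n x) < (1/2)^n / 2"
          using h(2)[of n] L2_norm_commute[of f "h n"] by simp
        ultimately show "L2_norm (\<lambda>x. Q k x - g x)
            \<le> L2_norm (\<lambda>x. k x - f x) + (1/2)^n / 2 + L2_norm (\<lambda>x. Q (h n) x - g x)"
          by linarith
      qed
    qed
    with g(1) show ?thesis by (auto simp: P_def)
  qed
  then obtain T where T: "\<And>f. f \<in> L2_space \<Longrightarrow> P f (T f)"
    by metis
  have TL2: "T f \<in> L2_space" if "f \<in> L2_space" for f
    using T[OF that] by (simp add: P_def)
  have TQ: "L2_norm (\<lambda>x. Q h x - T f x) \<le> L2_norm (\<lambda>x. h x - f x)" if "f \<in> L2_space" "h \<in> D" for f h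
    using T[OF that(1)] that(2) by (simp add: P_def)
  have "is_L2_extension Q T"
    unfolding is_L2_extension_def
  proof (intro conjI ballI impI allI)
    fix f :: "'a \<Rightarrow> complex" assume f: "f \<in> L2_space"
    show "T f \<in> L2_space" by (rule TL2[OF f])
    show "AE x in lebesgue. T f x = Q f x" if "integrable lebesgue f"
    proof -
      have fD: "f \<in> D" using f that by (simp add: D_def)
      have "L2_norm (\<lambda>x. Q f x - T f x) = 0"
        using TQ[OF f fD] L2_norm_nonneg[of "\<lambda>x. Q f x - T f x"] by simp
      from L2_norm_eq_0[OF L2_space_diff[OF D(2)[OF fD] TL2[OF f]] this]
      show ?thesis by eventually_elim simp
    qed
    fix e :: real assume "0 < e"
    show "\<exists>\<delta>>0. \<forall>g\<in>L2_space. L2_norm (\<lambda>x. g x - f x) < \<delta> \<longrightarrow> L2_norm (\<lambda>x. T g x - T f x) < e"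
    proof (intro exI[of _ "e / 2"] conjI ballI impI)
      fix g :: "'a \<Rightarrow> complex" assume g: "g \<in> L2_space" and gf: "L2_norm (\<lambda>x. g x - f x) < e / 2"
      obtain h where h: "h \<in> D" "L2_norm (\<lambda>x. h x - f x) < e / 4"
        using dense[OF f, of "e / 4"] \<open>0 < e\<close> by auto
      have "L2_norm (\<lambda>x. T g x - T f x) \<le> L2_norm (\<lambda>x. T g x - Q h x) + L2_norm (\<lambda>x. Q h x - T f x)"
        by (intro L2_norm_diff_triangle TL2 D f g h)
      moreover have "L2_norm (\<lambda>x. T g x - Q h x) \<le> L2_norm (\<lambda>x. h x - g x)"
        using TQ[OF g h(1)] L2_norm_commute[of "T g" "Q h"] by simp
      moreover have "L2_norm (\<lambda>x. h x - g x) \<le> L2_norm (\<lambda>x. h x - f x) + L2_norm (\<lambda>x. f x - g x)"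
        by (intro L2_norm_diff_triangle D f g h)
      moreover have "L2_norm (\<lambda>x. f x - g x) = L2_norm (\<lambda>x. g x - f x)"
        by (rule L2_norm_commute)
      moreover note TQ[OF f h(1)]
      ultimately show "L2_norm (\<lambda>x. T g x - T f x) < e"
        using gf h(2) by linarith
    qed (use \<open>0 < e\<close> in simp)
  qed
  then show ?thesis
    unfolding L2_extension_def by (rule someI[where P="is_L2_extension Q"])
qed

section \<open>Integrals over Euclidean space\<close>

lemma lebesgue_ex_borel:
  fixes f :: "'a::euclidean_space \<Rightarrow> complex"
  assumes f[measurable]: "f \<in> borel_measurable lebesgue"
  obtains g where "g \<in> borel_measurable borel" "AE x in lebesgue. f x = g x"
proof -
  have "(\<lambda>x. Re (f x)) \<in> borel_measurable lebesgue" "(\<lambda>x. Im (f x)) \<in> borel_measurable lebesgue"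
    by measurable
  from this[THEN completion_ex_borel_measurable_real]
  obtain r i where [measurable]: "r \<in> borel_measurable lborel" "i \<in> borel_measurable lborel"
    and ae: "AE x in lborel. Re (f x) = r x" "AE x in lborel. Im (f x) = i x"
    by auto
  show ?thesis
  proof
    show "(\<lambda>x. of_real (r x) + \<i> * of_real (i x)) \<in> borel_measurable borel"
      by measurable
    have "AE x in lborel. f x = of_real (r x) + \<i> * of_real (i x)"
      using ae by eventually_elim (simp add: complex_eq_iff)
    then show "AE x in lebesgue. f x = of_real (r x) + \<i> * of_real (i x)"
      by (rule AE_completion)
  qed
qed

lemma borel_measurable_cnj [measurable (raw)]:
  "f \<in> borel_measurable M \<Longrightarrow> (\<lambda>x. cnj (f x)) \<in> borel_measurable M"
  by (rule borel_measurable_continuous_on[of cnj]) (auto intro: continuous_intros)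

text \<open>
  Fubini's theorem is applied to Borel functions and the uncompleted Lebesgue measure, which these facts connect
  with the completed measure in the definition of \<open>L\<^sup>2\<close>.
\<close>
lemma L2_space_borel_iff:
  fixes f :: "'a::euclidean_space \<Rightarrow> complex"
  assumes [measurable]: "f \<in> borel_measurable borel"
  shows "f \<in> L2_space \<longleftrightarrow> integrable lborel (\<lambda>x. (cmod (f x))\<^sup>2)"
    and "(L2_norm f)\<^sup>2 = (LINT x|lborel. (cmod (f x))\<^sup>2)"
    and "integrable lebesgue f \<longleftrightarrow> integrable lborel f"
proof -
  have m: "f \<in> borel_measurable lborel" "(\<lambda>x. (cmod (f x))\<^sup>2) \<in> borel_measurable lborel"
    by auto
  show "f \<in> L2_space \<longleftrightarrow> integrable lborel (\<lambda>x. (cmod (f x))\<^sup>2)"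
    using measurable_completion[OF m(1)] integrable_completion[OF m(2)] by (simp add: L2_space_def)
  show "(L2_norm f)\<^sup>2 = (LINT x|lborel. (cmod (f x))\<^sup>2)"
    using integral_completion[OF m(2)] by (simp add: L2_norm_power2)
  show "integrable lebesgue f \<longleftrightarrow> integrable lborel f"
    by (rule integrable_completion[OF m(1)])
qed

text \<open>
  The law of cosines in \<open>L\<^sup>2\<close>, for a real inner product.
\<close>
lemma L2_norm_diff_power2:
  fixes u f G :: "'a::euclidean_space \<Rightarrow> complex"
  assumes u[measurable]: "u \<in> borel_measurable borel" and u2: "u \<in> L2_space"
    and f[measurable]: "f \<in> borel_measurable borel" and f2: "f \<in> L2_space"
    and inner: "(LINT x|lborel. cnj (f x) * u x) = of_real c"
  shows "(L2_norm (\<lambda>x. u x - f x))\<^sup>2 = (L2_norm u)\<^sup>2 - 2 * c + (L2_norm f)\<^sup>2"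
proof -
  have u2': "integrable lborel (\<lambda>x. (cmod (u x))\<^sup>2)" and f2': "integrable lborel (\<lambda>x. (cmod (f x))\<^sup>2)"
    using u2 f2 L2_space_borel_iff(1)[OF u] L2_space_borel_iff(1)[OF f] by auto
  have int: "integrable lborel (\<lambda>x. cnj (f x) * u x)"
  proof (rule Bochner_Integration.integrable_bound[OF Bochner_Integration.integrable_add[OF u2' f2']])
    have "cmod (cnj (f x) * u x) \<le> \<bar>(cmod (u x))\<^sup>2 + (cmod (f x))\<^sup>2\<bar>" for x
    proof -
      have "2 * (cmod (u x) * cmod (f x)) \<le> (cmod (u x))\<^sup>2 + (cmod (f x))\<^sup>2"
        using sum_squares_bound[of "cmod (u x)" "cmod (f x)"] by (simp add: mult.assoc)
      moreover have "0 \<le> cmod (u x) * cmod (f x)"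
        by simp
      moreover have "cmod (cnj (f x) * u x) = cmod (u x) * cmod (f x)"
        by (simp add: norm_mult)
      ultimately show ?thesis by linarith
    qed
    then show "AE x in lborel. norm (cnj (f x) * u x) \<le> norm ((cmod (u x))\<^sup>2 + (cmod (f x))\<^sup>2)"
      by simp
  qed measurable
  define r where "r x = Re (cnj (f x) * u x)" for x
  have r: "integrable lborel r" "(LINT x|lborel. r x) = c"
    using integrable_Re[OF int] integral_Re[OF int] inner by (simp_all add: r_def[abs_def])
  have expand: "(cmod (u x - f x))\<^sup>2 = (cmod (u x))\<^sup>2 - 2 * r x + (cmod (f x))\<^sup>2" for x
    unfolding cmod_power2 r_def by (simp add: power2_eq_square algebra_simps)
  have "(\<lambda>x. u x - f x) \<in> borel_measurable borel"
    by measurable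
  then show ?thesis
    using u2' f2' r by (simp add: L2_space_borel_iff(2) expand)
qed

text \<open>
  Lebesgue measure on the vectors is the image of a product measure indexed by the standard basis; the work is
  in reindexing the basis by the coordinates.
\<close>
lemma lborel_vec_prod:
  fixes f :: "'n::finite \<Rightarrow> real \<Rightarrow> 'b::{real_normed_field,banach,second_countable_topology}"
  assumes int: "\<And>k. integrable lborel (f k)"
  shows integrable_lborel_vec_prod: "integrable lborel (\<lambda>x::real^'n. \<Prod>k\<in>UNIV. f k (x $ k))"
    and integral_lborel_vec_prod: "(LINT x|lborel. (\<Prod>k\<in>UNIV. f k (x $ k))) = (\<Prod>k\<in>UNIV. LINT t|lborel. f k t)"
proof -
  interpret product_sigma_finite "\<lambda>_::real^'n. lborel :: real measure" ..
  define F where "F b = f (inv (\<lambda>k. axis k (1::real)) b)" for b :: "real^'n"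
  have inj: "inj (\<lambda>k::'n. axis k (1::real))"
    by (auto simp: inj_def axis_eq_axis)
  have F_axis: "F (axis k 1) = f k" for k
    by (simp add: F_def inv_f_f[OF inj])
  have Basis: "Basis = range (\<lambda>k::'n. axis k (1::real))"
    by (auto simp: Basis_vec_def)
  have F_int: "integrable lborel (F b)" for b
    unfolding F_def by (rule int)
  have [measurable]: "f k \<in> borel_measurable borel" for k
    using borel_measurable_integrable[OF int[of k]] by simp
  have nth: "(\<Sum>b\<in>Basis. g b *\<^sub>R b) $ k = g (axis k 1)" for g :: "real^'n \<Rightarrow> real" and k
  proof -
    have "(\<Sum>b\<in>Basis. g b *\<^sub>R b) $ k = (\<Sum>b\<in>Basis. g b *\<^sub>R b) \<bullet> axis k 1"
      by (simp add: cart_eq_inner_axis)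
    also have "\<dots> = g (axis k 1)"
      by (rule inner_sum_left_Basis) (auto simp: Basis)
    finally show ?thesis .
  qed
  have prod: "(\<Prod>k\<in>UNIV. f k ((\<Sum>b\<in>Basis. g b *\<^sub>R b) $ k)) = (\<Prod>b\<in>Basis. F b (g b))"
    for g :: "real^'n \<Rightarrow> real"
  proof -
    have "(\<Prod>b\<in>Basis. F b (g b)) = (\<Prod>k\<in>UNIV. f k (g (axis k 1)))"
      unfolding Basis by (subst prod.reindex[OF inj]) (simp add: F_axis)
    then show ?thesis by (simp only: nth)
  qed
  have m1: "(\<lambda>g. \<Sum>b\<in>Basis. g b *\<^sub>R b) \<in> measurable (\<Pi>\<^sub>M b\<in>Basis. lborel) (borel :: (real^'n) measure)"
    by measurable
  have m2: "(\<lambda>x::real^'n. \<Prod>k\<in>UNIV. f k (x $ k)) \<in> borel_measurable borel"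
    by measurable
  show "integrable lborel (\<lambda>x::real^'n. \<Prod>k\<in>UNIV. f k (x $ k))"
    unfolding lborel_eq[where 'a="real^'n"] integrable_distr_eq[OF m1 m2] prod
    by (rule product_integrable_prod) (auto intro: F_int)
  have "(LINT x|lborel. (\<Prod>k\<in>UNIV. f k ((x::real^'n) $ k))) = (\<Prod>b\<in>Basis. LINT t|lborel. F b t)"
    unfolding lborel_eq[where 'a="real^'n"] integral_distr[OF m1 m2] prod
    by (rule product_integral_prod) (auto intro: F_int)
  also have "\<dots> = (\<Prod>k\<in>UNIV. LINT t|lborel. f k t)"
    unfolding Basis by (subst prod.reindex[OF inj]) (simp add: F_axis)
  finally show "(LINT x|lborel. (\<Prod>k\<in>UNIV. f k ((x::real^'n) $ k))) = (\<Prod>k\<in>UNIV. LINT t|lborel. f k t)" .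
qed

text \<open>
  Fubini for an integral operator with bounded kernel, against integrable functions. The regularized
  Parseval identity and the adjointness of the two transforms both rest on it.
\<close>
lemma multiplication_formula:
  fixes K :: "'a::euclidean_space \<Rightarrow> 'b::euclidean_space \<Rightarrow> complex"
  assumes K[measurable]: "case_prod K \<in> borel_measurable (borel \<Otimes>\<^sub>M borel)"
    and bound: "\<And>x y. cmod (K x y) \<le> C"
    and u: "integrable lborel u" and v: "integrable lborel v"
  shows "(LINT x|lborel. u x * (LINT y|lborel. K x y * v y))
      = (LINT y|lborel. v y * (LINT x|lborel. K x y * u x))"
proof -
  note [measurable] = borel_measurable_integrable[OF u, simplified] borel_measurable_integrable[OF v, simplified]
  have "integrable (lborel \<Otimes>\<^sub>M lborel) (\<lambda>(x, y). norm (u x) * norm (v y))"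
    using u v by (intro lborel_pair.Fubini_integrable) (auto intro!: integrable_mult_right integrable_mult_left)
  then have "integrable (lborel \<Otimes>\<^sub>M lborel) (\<lambda>z. C * (case z of (x, y) \<Rightarrow> norm (u x) * norm (v y)))"
    by (rule integrable_mult_right)
  moreover have "cmod (u x * (K x y * v y)) \<le> \<bar>C * (cmod (u x) * cmod (v y))\<bar>" for x y
  proof -
    have "cmod (u x * (K x y * v y)) = cmod (K x y) * (cmod (u x) * cmod (v y))"
      by (simp add: norm_mult)
    also have "\<dots> \<le> C * (cmod (u x) * cmod (v y))"
      by (intro mult_right_mono bound) auto
    finally show ?thesis by linarith
  qed
  ultimately have int: "integrable (lborel \<Otimes>\<^sub>M lborel) (\<lambda>(x, y). u x * (K x y * v y))"
    by (elim Bochner_Integration.integrable_bound) (auto simp: split_beta)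
  have "(LINT x|lborel. u x * (LINT y|lborel. K x y * v y))
      = (LINT x|lborel. LINT y|lborel. u x * (K x y * v y))"
    by simp
  also have "\<dots> = (LINT y|lborel. LINT x|lborel. u x * (K x y * v y))"
    by (rule lborel_pair.Fubini_integral[OF int, symmetric])
  also have "(\<lambda>y. LINT x|lborel. u x * (K x y * v y)) = (\<lambda>y. v y * (LINT x|lborel. K x y * u x))"
    by (intro ext) (simp add: mult_ac flip: integral_mult_right_zero)
  finally show ?thesis .
qed

lemma integral_lborel_affine:
  fixes f :: "'a::euclidean_space \<Rightarrow> 'b::{banach, second_countable_topology}"
  assumes [measurable]: "f \<in> borel_measurable borel" and c: "c \<noteq> 0"
  shows "(LINT x|lborel. f x) = \<bar>c\<bar> ^ DIM('a) *\<^sub>R (LINT x|lborel. f (t + c *\<^sub>R x))"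
  by (subst lborel_affine[OF c, of t]) (simp add: integral_density integral_distr)

lemma nn_integral_lborel_reflect:
  fixes f :: "'a::euclidean_space \<Rightarrow> ennreal"
  assumes [measurable]: "f \<in> borel_measurable borel"
  shows "(\<integral>\<^sup>+y. f (x - y) \<partial>lborel) = (\<integral>\<^sup>+y. f y \<partial>lborel)"
proof -
  have "(\<integral>\<^sup>+y. f y \<partial>lborel) = (\<integral>\<^sup>+y. f y \<partial>density (distr lborel borel (\<lambda>y. x + (-1) *\<^sub>R y)) (\<lambda>_. ennreal (\<bar>-1\<bar>^DIM('a))))"
    using lborel_affine[of "-1" x] by simp
  also have "\<dots> = (\<integral>\<^sup>+y. f (x - y) \<partial>lborel)"
    by (simp add: nn_integral_density nn_integral_distr)
  finally show ?thesis ..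
qed

text \<open>
  When \<open>f\<close> is not integrable, the left-hand side is \<open>0\<close>. The Schur estimate below applies this to inner
  integrals that might exist only for almost every \<open>x\<close>.
\<close>
lemma ennreal_norm_integral_le:
  "ennreal (norm (integral\<^sup>L M f)) \<le> (\<integral>\<^sup>+x. norm (f x) \<partial>M)"
  by (cases "integrable M f") (auto simp: integral_norm_bound_ennreal not_integrable_integral_eq)

text \<open>
  Schur's test: bounding \<open>|h x| |h y|\<close> by \<open>(|h x|\<^sup>2 + |h y|\<^sup>2) / 2\<close> leaves two terms, in each of which one variable
  occurs only in \<open>k (x - y)\<close> and integrates to \<open>1\<close>.
\<close>
lemma convolution_form_bound:
  fixes h :: "'a::euclidean_space \<Rightarrow> complex" and k :: "'a \<Rightarrow> real"
  assumes h[measurable]: "h \<in> borel_measurable borel" and h2: "integrable lborel (\<lambda>x. (cmod (h x))\<^sup>2)"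
    and k: "integrable lborel k" and k_nonneg: "\<And>x. 0 \<le> k x" and k1: "(LINT x|lborel. k x) = 1"
  shows "cmod (LINT x|lborel. h x * cnj (LINT y|lborel. h y * k (x - y))) \<le> (LINT x|lborel. (cmod (h x))\<^sup>2)"
proof -
  note [measurable] = borel_measurable_integrable[OF k, simplified]
  have nn_k: "(\<integral>\<^sup>+x. ennreal (k x) \<partial>lborel) = 1"
    using nn_integral_eq_integral[OF k] k_nonneg k1 by simp
  have k_y: "(\<integral>\<^sup>+y. ennreal (k (x - y)) \<partial>lborel) = 1" for x
    using nn_integral_lborel_reflect[of "\<lambda>x. ennreal (k x)" x] nn_k by simp
  have k_x: "(\<integral>\<^sup>+x. ennreal (k (x - y)) \<partial>lborel) = 1" for y
  proof -
    have "(\<integral>\<^sup>+x. ennreal (k (x - y)) \<partial>lborel) = (\<integral>\<^sup>+x. ennreal (k x) \<partial>distr lborel borel ((+) (- y)))"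
      by (subst nn_integral_distr) auto
    then show ?thesis using nn_k by (simp add: lborel_distr_plus)
  qed
  have "ennreal (cmod (LINT x|lborel. h x * cnj (LINT y|lborel. h y * k (x - y))))
      \<le> (\<integral>\<^sup>+x. cmod (h x * cnj (LINT y|lborel. h y * k (x - y))) \<partial>lborel)"
    by (rule ennreal_norm_integral_le)
  also have "\<dots> = (\<integral>\<^sup>+x. ennreal (cmod (h x)) * ennreal (cmod (LINT y|lborel. h y * k (x - y))) \<partial>lborel)"
    by (simp add: norm_mult ennreal_mult)
  also have "\<dots> \<le> (\<integral>\<^sup>+x. ennreal (cmod (h x)) * (\<integral>\<^sup>+y. cmod (h y * k (x - y)) \<partial>lborel) \<partial>lborel)"
    by (intro nn_integral_mono mult_left_mono ennreal_norm_integral_le) auto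
  also have "\<dots> = (\<integral>\<^sup>+x. \<integral>\<^sup>+y. ennreal (cmod (h x) * (cmod (h y) * k (x - y))) \<partial>lborel \<partial>lborel)"
    using k_nonneg by (subst nn_integral_cmult[symmetric]) (auto simp: norm_mult ennreal_mult)
  also have "\<dots> \<le> (\<integral>\<^sup>+x. \<integral>\<^sup>+y. ennreal ((cmod (h x))\<^sup>2 / 2) * ennreal (k (x - y))
      + ennreal ((cmod (h y))\<^sup>2 / 2) * ennreal (k (x - y)) \<partial>lborel \<partial>lborel)"
  proof (intro nn_integral_mono)
    fix x y
    have "0 \<le> k (x - y) * (cmod (h x) - cmod (h y))\<^sup>2" using k_nonneg by simp
    then have "cmod (h x) * (cmod (h y) * k (x - y))
        \<le> (cmod (h x))\<^sup>2 / 2 * k (x - y) + (cmod (h y))\<^sup>2 / 2 * k (x - y)"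
      by (simp add: power2_eq_square field_simps)
    then show "ennreal (cmod (h x) * (cmod (h y) * k (x - y)))
        \<le> ennreal ((cmod (h x))\<^sup>2 / 2) * ennreal (k (x - y)) + ennreal ((cmod (h y))\<^sup>2 / 2) * ennreal (k (x - y))"
      using k_nonneg by (simp add: ennreal_leI flip: ennreal_mult ennreal_plus)
  qed
  also have "\<dots> = (\<integral>\<^sup>+x. \<integral>\<^sup>+y. ennreal ((cmod (h x))\<^sup>2 / 2) * ennreal (k (x - y)) \<partial>lborel \<partial>lborel)
      + (\<integral>\<^sup>+x. \<integral>\<^sup>+y. ennreal ((cmod (h y))\<^sup>2 / 2) * ennreal (k (x - y)) \<partial>lborel \<partial>lborel)"
    by (simp add: nn_integral_add)
  also have "(\<integral>\<^sup>+x. \<integral>\<^sup>+y. ennreal ((cmod (h y))\<^sup>2 / 2) * ennreal (k (x - y)) \<partial>lborel \<partial>lborel)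
      = (\<integral>\<^sup>+y. \<integral>\<^sup>+x. ennreal ((cmod (h y))\<^sup>2 / 2) * ennreal (k (x - y)) \<partial>lborel \<partial>lborel)"
    by (rule lborel_pair.Fubini'[symmetric]) measurable
  also have "\<dots> = (\<integral>\<^sup>+y. ennreal ((cmod (h y))\<^sup>2 / 2) \<partial>lborel)"
    by (simp add: nn_integral_cmult k_x)
  also have "(\<integral>\<^sup>+x. \<integral>\<^sup>+y. ennreal ((cmod (h x))\<^sup>2 / 2) * ennreal (k (x - y)) \<partial>lborel \<partial>lborel)
      = (\<integral>\<^sup>+y. ennreal ((cmod (h y))\<^sup>2 / 2) \<partial>lborel)"
    by (simp add: nn_integral_cmult k_y)
  also have "(\<integral>\<^sup>+y. ennreal ((cmod (h y))\<^sup>2 / 2) \<partial>lborel) + (\<integral>\<^sup>+y. ennreal ((cmod (h y))\<^sup>2 / 2) \<partial>lborel)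
      = ennreal (LINT x|lborel. (cmod (h x))\<^sup>2)"
    using h2 by (simp add: nn_integral_eq_integral flip: ennreal_plus)
  finally show ?thesis
    by (subst (asm) ennreal_le_iff) auto
qed

section \<open>Gaussians as Fourier transforms and as an approximate identity\<close>

text \<open>
  The characteristic function of the standard normal law after the substitution \<open>u = e b w\<close>. With \<open>b\<close> inside
  the Gaussian the right-hand side is a normal density whose width does not depend on \<open>b\<close>.
\<close>
lemma fourier_gaussian:
  fixes b e z :: real
  assumes b: "b \<noteq> 0" and e: "0 < e"
  shows "integrable lborel (\<lambda>w. exp (\<i> * of_real (b * z * w)) * of_real (exp (- (e * b * w)\<^sup>2 / 2)))" (is "integrable _ ?f")
    and "(LINT w|lborel. exp (\<i> * of_real (b * z * w)) * of_real (exp (- (e * b * w)\<^sup>2 / 2)))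
      = of_real (2 * pi / \<bar>b\<bar> * normal_density 0 e z)"
proof -
  define g where "g u = std_normal_density u *\<^sub>R iexp ((z / e) * u)" for u
  have g_int: "integrable lborel g"
    unfolding g_def using integrable_normal_density[of 1 0]
    by (rule Bochner_Integration.integrable_bound) auto
  have "char std_normal_distribution (z / e) = (LINT u|lborel. g u)"
    unfolding char_def g_def by (subst integral_density) auto
  then have g_val: "(LINT u|lborel. g u) = of_real (exp (- ((z / e)\<^sup>2) / 2))"
    by (simp add: char_std_normal_distribution)
  have c: "e * b \<noteq> 0" using assms by simp
  have eq: "?f w = of_real (sqrt (2 * pi)) * g (0 + (e * b) * w)" for w
    using e by (simp add: g_def std_normal_density_def scaleR_conv_of_real field_simps)
  have "integrable lborel (\<lambda>w. g (0 + (e * b) * w))"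
    using g_int lborel_integrable_real_affine[OF _ c] by blast
  then show "integrable lborel ?f"
    unfolding eq by (rule integrable_mult_right)
  have "(LINT w|lborel. ?f w) = of_real (sqrt (2 * pi)) * (LINT w|lborel. g (0 + (e * b) * w))"
    unfolding eq by simp
  also have "(LINT w|lborel. g (0 + (e * b) * w)) = (LINT u|lborel. g u) /\<^sub>R \<bar>e * b\<bar>"
    using lborel_integral_real_affine[OF c, of g 0] c by simp
  also have "of_real (sqrt (2 * pi)) * ((LINT u|lborel. g u) /\<^sub>R \<bar>e * b\<bar>)
      = complex_of_real (sqrt (2 * pi) / \<bar>e * b\<bar> * exp (- ((z / e)\<^sup>2) / 2))"
    unfolding g_val by (simp add: scaleR_conv_of_real field_simps)
  also have "sqrt (2 * pi) / \<bar>e * b\<bar> * exp (- ((z / e)\<^sup>2) / 2) = 2 * pi / \<bar>b\<bar> * normal_density 0 e z"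
    using e b by (simp add: normal_density_def real_sqrt_mult abs_mult power_divide field_simps)
  finally show "(LINT w|lborel. ?f w) = of_real (2 * pi / \<bar>b\<bar> * normal_density 0 e z)" .
qed

definition gauss_density :: "real \<Rightarrow> real ^ 'n::finite \<Rightarrow> real" where
  "gauss_density e z = (\<Prod>k\<in>UNIV. normal_density 0 e (z $ k))"

lemma gauss_density_nonneg: "0 \<le> gauss_density e z"
  by (simp add: gauss_density_def prod_nonneg)

lemma borel_measurable_gauss_density [measurable]: "gauss_density e \<in> borel_measurable borel"
  unfolding gauss_density_def by measurable

lemma gauss_density_integral:
  assumes "0 < e"
  shows "integrable lborel (gauss_density e :: real ^ 'n::finite \<Rightarrow> real)"
    and "(LINT z|lborel. gauss_density e (z :: real ^ 'n::finite)) = 1"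
  using lborel_vec_prod[where f="\<lambda>_::'n. normal_density 0 e"] assms
  by (simp_all add: gauss_density_def[abs_def])

lemma gauss_density_scale:
  assumes "0 < e"
  shows "\<bar>e\<bar> ^ CARD('n) * gauss_density e (e *\<^sub>R u) = gauss_density 1 (u :: real ^ 'n::finite)"
proof -
  have "e * normal_density 0 e (e * t) = normal_density 0 1 t" for t
    using assms by (simp add: normal_density_def real_sqrt_mult power_mult_distrib)
  moreover have "\<bar>e\<bar> ^ CARD('n) * gauss_density e (e *\<^sub>R u)
      = (\<Prod>k\<in>UNIV. e * normal_density 0 e (e * (u $ k)))"
    using assms by (simp add: gauss_density_def prod.distrib)
  ultimately show ?thesis by (simp add: gauss_density_def)
qed

text \<open>
  The substitution \<open>y = x - e u\<close> moves the width \<open>e\<close> from the density into the argument of \<open>h\<close>, where continuity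
  and dominated convergence apply.
\<close>
lemma gauss_density_approximate_identity:
  fixes h :: "real ^ 'n::finite \<Rightarrow> complex"
  assumes h: "continuous_on UNIV h" and bound: "\<And>x. cmod (h x) \<le> B"
    and e: "\<And>n. 0 < e n" "e \<longlonglongrightarrow> 0"
  shows "(\<lambda>n. LINT y|lborel. h y * gauss_density (e n) (x - y)) \<longlonglongrightarrow> h x"
    and "\<And>n. cmod (LINT y|lborel. h y * gauss_density (e n) (x - y)) \<le> B"
proof -
  have [measurable]: "h \<in> borel_measurable borel"
    using h by (rule borel_measurable_continuous_onI)
  have int1: "integrable lborel (\<lambda>u :: real ^ 'n. B * gauss_density 1 u)"
    by (intro integrable_mult_right gauss_density_integral) simp
  have eq: "(LINT y|lborel. h y * gauss_density (e n) (x - y))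
      = (LINT u|lborel. h (x + (- e n) *\<^sub>R u) * gauss_density 1 u)" for n
  proof -
    have "(LINT y|lborel. h y * gauss_density (e n) (x - y))
        = \<bar>- e n\<bar> ^ DIM(real ^ 'n) *\<^sub>R (LINT u|lborel. h (x + (- e n) *\<^sub>R u) * gauss_density (e n) (x - (x + (- e n) *\<^sub>R u)))"
      by (rule integral_lborel_affine) (use e(1)[of n] in auto)
    also have "\<dots> = (LINT u|lborel. \<bar>e n\<bar> ^ CARD('n) *\<^sub>R (h (x + (- e n) *\<^sub>R u) * gauss_density (e n) (e n *\<^sub>R u)))"
      by simp
    also have "\<dots> = (LINT u|lborel. h (x + (- e n) *\<^sub>R u) * of_real (\<bar>e n\<bar> ^ CARD('n) * gauss_density (e n) (e n *\<^sub>R u)))"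
      by (simp add: scaleR_conv_of_real mult_ac)
    finally show ?thesis
      unfolding gauss_density_scale[OF e(1)] .
  qed
  have le: "norm (h (x + (- e n) *\<^sub>R u) * gauss_density 1 u) \<le> B * gauss_density 1 u" for n u
    using bound gauss_density_nonneg[of 1 u] by (simp add: norm_mult mult_right_mono)
  have "(\<lambda>n. LINT u|lborel. h (x + (- e n) *\<^sub>R u) * gauss_density 1 u)
      \<longlonglongrightarrow> (LINT u::real^'n|lborel. h x * gauss_density 1 u)"
  proof (rule integral_dominated_convergence[OF _ _ int1])
    show "AE u in lborel. (\<lambda>n. h (x + (- e n) *\<^sub>R u) * gauss_density 1 u) \<longlonglongrightarrow> h x * gauss_density 1 u"
    proof (intro AE_I2 tendsto_intros)
      fix u
      have "(\<lambda>n. x + (- e n) *\<^sub>R u) \<longlonglongrightarrow> x + (- 0) *\<^sub>R u"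
        by (intro tendsto_intros e)
      then show "(\<lambda>n. h (x + (- e n) *\<^sub>R u)) \<longlonglongrightarrow> h x"
        using continuous_on_tendsto_compose[OF h] by simp
    qed
  qed (use le in auto)
  then show "(\<lambda>n. LINT y|lborel. h y * gauss_density (e n) (x - y)) \<longlonglongrightarrow> h x"
    unfolding eq by (simp add: gauss_density_integral)
  show "cmod (LINT y|lborel. h y * gauss_density (e n) (x - y)) \<le> B" for n
  proof -
    have "cmod (LINT y|lborel. h y * gauss_density (e n) (x - y)) \<le> (LINT u::real^'n|lborel. B * gauss_density 1 u)"
      unfolding eq
    proof (rule Bochner_Integration.integral_norm_bound_integral[OF _ int1 le])
      show "integrable lborel (\<lambda>u. h (x + (- e n) *\<^sub>R u) * gauss_density 1 u)"
        by (rule Bochner_Integration.integrable_bound[OF int1])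
           (measurable, use order_trans[OF le abs_ge_self] in \<open>simp only: real_norm_def AE_I2\<close>)
    qed
    then show ?thesis by (simp add: gauss_density_integral)
  qed
qed

section \<open>The kernel and its damped products\<close>

text \<open>
  The phase factor of the kernel that depends on \<open>x\<close> alone. Multiplication by it preserves absolute values.
\<close>
definition qpft_chirp :: "('n::finite \<Rightarrow> qp_param) \<Rightarrow> real ^ 'n \<Rightarrow> complex" where
  "qpft_chirp \<Lambda> x = (\<Prod>k\<in>UNIV. cis (par_a (\<Lambda> k) * (x $ k)\<^sup>2 + par_d (\<Lambda> k) * (x $ k)))"

text \<open>
  A Gaussian in \<open>w\<close> tending to \<open>1\<close> as \<open>e\<close> tends to \<open>0\<close>. The factor \<open>b\<^sub>k\<close> in the exponent makes the damped product
  of two kernels produce a normal density of width \<open>e\<close> in every coordinate.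
\<close>
definition qpft_damping :: "('n::finite \<Rightarrow> qp_param) \<Rightarrow> real \<Rightarrow> real ^ 'n \<Rightarrow> real" where
  "qpft_damping \<Lambda> e w = (\<Prod>k\<in>UNIV. exp (- (e * par_b (\<Lambda> k) * (w $ k))\<^sup>2 / 2))"

text \<open>
  The modulus of the kernel, which is the same at all points.
\<close>
definition qpft_bound :: "('n::finite \<Rightarrow> qp_param) \<Rightarrow> real" where
  "qpft_bound \<Lambda> = (\<Prod>k\<in>UNIV. sqrt (\<bar>par_b (\<Lambda> k)\<bar> / (2 * pi)))"

lemma norm_qpft_chirp [simp]: "cmod (qpft_chirp \<Lambda> x) = 1"
  by (simp add: qpft_chirp_def flip: prod_norm)

lemma continuous_on_qpft_chirp: "continuous_on UNIV (qpft_chirp \<Lambda>)"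
  unfolding qpft_chirp_def cis_conv_exp by (intro continuous_intros)

lemma borel_measurable_qpft_chirp [measurable]: "qpft_chirp \<Lambda> \<in> borel_measurable borel"
  by (rule borel_measurable_continuous_onI[OF continuous_on_qpft_chirp])

lemma norm_qpft_kernel [simp]: "cmod (qpft_kernel \<Lambda> w x) = qpft_bound \<Lambda>"
  by (simp add: qpft_kernel_def qpft_bound_def norm_mult norm_divide flip: prod_norm)

lemma qpft_bound_nonneg: "0 \<le> qpft_bound \<Lambda>"
  by (simp add: qpft_bound_def prod_nonneg)

lemma continuous_on_qpft_kernel:
  assumes "continuous_on S f" "continuous_on S g"
  shows "continuous_on S (\<lambda>z. qpft_kernel \<Lambda> (f z) (g z))"
  unfolding qpft_kernel_def qp_phase_def using assms by (intro continuous_intros)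

lemma borel_measurable_qpft_kernel [measurable]:
  "(\<lambda>z. qpft_kernel \<Lambda> (fst z) (snd z)) \<in> borel_measurable (borel \<Otimes>\<^sub>M borel)"
  unfolding borel_prod
  by (intro borel_measurable_continuous_onI continuous_on_qpft_kernel continuous_intros)

lemma borel_measurable_qpft_kernel_left [measurable]: "(\<lambda>w. qpft_kernel \<Lambda> w x) \<in> borel_measurable borel"
  by (intro borel_measurable_continuous_onI continuous_on_qpft_kernel continuous_intros)

lemma borel_measurable_qpft_kernel_right [measurable]: "qpft_kernel \<Lambda> w \<in> borel_measurable borel"
  by (intro borel_measurable_continuous_onI continuous_on_qpft_kernel[of _ "\<lambda>_. w" "\<lambda>x. x"] continuous_intros)

lemma qpft_damping_bounds: "0 \<le> qpft_damping \<Lambda> e w" "qpft_damping \<Lambda> e w \<le> 1"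
  by (auto simp: qpft_damping_def intro!: prod_nonneg prod_le_1)

lemma borel_measurable_qpft_damping [measurable]: "qpft_damping \<Lambda> e \<in> borel_measurable borel"
  unfolding qpft_damping_def by measurable

lemma qpft_damping_tendsto:
  assumes "e \<longlonglongrightarrow> 0"
  shows "(\<lambda>n. qpft_damping \<Lambda> (e n) w) \<longlonglongrightarrow> 1"
proof -
  have "(\<lambda>n. qpft_damping \<Lambda> (e n) w) \<longlonglongrightarrow> (\<Prod>k\<in>UNIV. exp (- (0 * par_b (\<Lambda> k) * (w $ k))\<^sup>2 / 2))"
    unfolding qpft_damping_def by (intro tendsto_intros assms) auto
  then show ?thesis by simp
qed

text \<open>
  In the product of one kernel with the conjugate of another at the same frequency, the terms in \<open>w\<close> alone
  cancel, the square roots combine to \<open>|b\<^sub>k| / 2\<pi>\<close>, and what remains in each coordinate is the Fourier transform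
  of a Gaussian at \<open>x - y\<close>.
\<close>
lemma qpft_kernel_reproducing:
  fixes x y :: "real ^ 'n::finite"
  assumes b: "\<And>k. par_b (\<Lambda> k) \<noteq> 0" and e: "0 < e"
  shows "integrable lborel (\<lambda>w. qpft_kernel \<Lambda> w x * cnj (qpft_kernel \<Lambda> w y) * of_real (qpft_damping \<Lambda> e w))"
    and "(LINT w|lborel. qpft_kernel \<Lambda> w x * cnj (qpft_kernel \<Lambda> w y) * of_real (qpft_damping \<Lambda> e w))
      = qpft_chirp \<Lambda> x * cnj (qpft_chirp \<Lambda> y) * of_real (gauss_density e (x - y))"
proof -
  define c where "c k = cis (par_a (\<Lambda> k) * (x $ k)\<^sup>2 + par_d (\<Lambda> k) * (x $ k))
      * cnj (cis (par_a (\<Lambda> k) * (y $ k)\<^sup>2 + par_d (\<Lambda> k) * (y $ k))) * of_real (\<bar>par_b (\<Lambda> k)\<bar> / (2 * pi))" for k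
  define g where "g k t = exp (\<i> * of_real (par_b (\<Lambda> k) * (x $ k - y $ k) * t))
      * of_real (exp (- (e * par_b (\<Lambda> k) * t)\<^sup>2 / 2))" for k t
  have fg: "integrable lborel (g k)"
    "(LINT t|lborel. g k t) = of_real (2 * pi / \<bar>par_b (\<Lambda> k)\<bar> * normal_density 0 e (x $ k - y $ k))" for k
    unfolding g_def[abs_def] by (rule fourier_gaussian[OF b e])+
  have regroup: "A * X * (A' * Y) * d = u * v * a * (G * d)"
    if "A * A' = a" "X * Y = u * v * G" for A A' X Y d u v a G :: complex
  proof -
    have "A * X * (A' * Y) * d = (A * A') * (X * Y) * d"
      by (simp only: mult_ac)
    also have "\<dots> = u * v * a * (G * d)"
      unfolding that by (simp only: mult_ac)
    finally show ?thesis .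
  qed
  have factor: "csqrt (of_real \<beta> / (2 * of_real pi * \<i>)) * exp (\<i> * of_real (qp_phase (\<Lambda> k) t (x $ k)))
      * cnj (csqrt (of_real \<beta> / (2 * of_real pi * \<i>)) * exp (\<i> * of_real (qp_phase (\<Lambda> k) t (y $ k))))
      * of_real (exp (- (e * \<beta> * t)\<^sup>2 / 2)) = c k * g k t"
    if \<beta>: "\<beta> = par_b (\<Lambda> k)" for k t \<beta>
  proof -
    have "csqrt (of_real \<beta> / (2 * of_real pi * \<i>)) * cnj (csqrt (of_real \<beta> / (2 * of_real pi * \<i>)))
        = of_real (\<bar>\<beta>\<bar> / (2 * pi))"
      by (simp add: complex_norm_square[symmetric] norm_divide norm_mult flip: of_real_power)
    moreover have "cis (qp_phase (\<Lambda> k) t (x $ k)) * cnj (cis (qp_phase (\<Lambda> k) t (y $ k)))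
        = cis (par_a (\<Lambda> k) * (x $ k)\<^sup>2 + par_d (\<Lambda> k) * (x $ k))
          * cnj (cis (par_a (\<Lambda> k) * (y $ k)\<^sup>2 + par_d (\<Lambda> k) * (y $ k))) * cis (\<beta> * (x $ k - y $ k) * t)"
      by (simp add: cis_cnj cis_mult qp_phase_def \<beta> algebra_simps)
    ultimately show ?thesis
      unfolding g_def c_def \<beta> cis_conv_exp[symmetric] complex_cnj_mult
      by (rule regroup)
  qed
  have eq: "qpft_kernel \<Lambda> w x * cnj (qpft_kernel \<Lambda> w y) * of_real (qpft_damping \<Lambda> e w)
      = (\<Prod>k\<in>UNIV. c k * g k (w $ k))" for w
    unfolding qpft_kernel_def qpft_damping_def cnj_prod of_real_prod prod.distrib[symmetric]
    by (intro prod.cong factor refl)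
  have int: "integrable lborel (\<lambda>t. c k * g k t)" for k
    by (intro integrable_mult_right fg)
  show "integrable lborel (\<lambda>w. qpft_kernel \<Lambda> w x * cnj (qpft_kernel \<Lambda> w y) * of_real (qpft_damping \<Lambda> e w))"
    unfolding eq by (rule integrable_lborel_vec_prod[OF int])
  have "(LINT w|lborel. qpft_kernel \<Lambda> w x * cnj (qpft_kernel \<Lambda> w y) * of_real (qpft_damping \<Lambda> e w))
      = (\<Prod>k\<in>UNIV. c k * of_real (2 * pi / \<bar>par_b (\<Lambda> k)\<bar> * normal_density 0 e (x $ k - y $ k)))"
    unfolding eq integral_lborel_vec_prod[OF int] by (simp only: integral_mult_right_zero fg)
  also have "\<dots> = (\<Prod>k\<in>UNIV. cis (par_a (\<Lambda> k) * (x $ k)\<^sup>2 + par_d (\<Lambda> k) * (x $ k))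
      * cnj (cis (par_a (\<Lambda> k) * (y $ k)\<^sup>2 + par_d (\<Lambda> k) * (y $ k))) * of_real (normal_density 0 e (x $ k - y $ k)))"
  proof (intro prod.cong refl)
    fix k
    have "complex_of_real (\<bar>par_b (\<Lambda> k)\<bar> / (2 * pi)) * of_real (2 * pi / \<bar>par_b (\<Lambda> k)\<bar> * N) = of_real N" for N
      unfolding of_real_mult[symmetric] using b[of k] by (intro arg_cong[where f=of_real]) simp
    then show "c k * of_real (2 * pi / \<bar>par_b (\<Lambda> k)\<bar> * normal_density 0 e (x $ k - y $ k))
      = cis (par_a (\<Lambda> k) * (x $ k)\<^sup>2 + par_d (\<Lambda> k) * (x $ k))
      * cnj (cis (par_a (\<Lambda> k) * (y $ k)\<^sup>2 + par_d (\<Lambda> k) * (y $ k))) * of_real (normal_density 0 e (x $ k - y $ k))"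
      unfolding c_def by (simp only: mult.assoc)
  qed
  also have "\<dots> = qpft_chirp \<Lambda> x * cnj (qpft_chirp \<Lambda> y) * of_real (gauss_density e (x - y))"
    by (simp add: qpft_chirp_def gauss_density_def prod.distrib)
  finally show "(LINT w|lborel. qpft_kernel \<Lambda> w x * cnj (qpft_kernel \<Lambda> w y) * of_real (qpft_damping \<Lambda> e w))
      = qpft_chirp \<Lambda> x * cnj (qpft_chirp \<Lambda> y) * of_real (gauss_density e (x - y))" .
qed

lemma qpft_damping_integrable:
  assumes b: "\<And>k. par_b (\<Lambda> k) \<noteq> 0" and e: "0 < e"
  shows "integrable lborel (qpft_damping \<Lambda> e)"
proof -
  have "integrable lborel (\<lambda>t. exp (- (e * par_b (\<Lambda> k) * t)\<^sup>2 / 2))" for k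
    using integrable_norm[OF fourier_gaussian(1)[OF b e, of k 0]] by simp
  from integrable_lborel_vec_prod[OF this] show ?thesis
    unfolding qpft_damping_def[abs_def] .
qed

section \<open>The regularized Parseval identity and the isometry\<close>

lemma qpft_L1_borel:
  assumes [measurable]: "f \<in> borel_measurable borel"
  shows "qpft_L1 \<Lambda> f w = (LINT x|lborel. qpft_kernel \<Lambda> w x * f x)"
  unfolding qpft_L1_def by (rule integral_completion) simp

lemma borel_measurable_qpft_L1:
  assumes [measurable]: "f \<in> borel_measurable borel"
  shows "qpft_L1 \<Lambda> f \<in> borel_measurable borel"
proof -
  have "(\<lambda>w. LINT x|lborel. qpft_kernel \<Lambda> w x * f x) \<in> borel_measurable borel"
    using borel_measurable_qpft_kernel
    by (intro lborel.borel_measurable_lebesgue_integral) (auto simp: split_beta)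
  then show ?thesis
    by (simp add: qpft_L1_borel[OF assms, abs_def])
qed

lemma norm_qpft_L1_le:
  assumes [measurable]: "f \<in> borel_measurable borel" and f: "integrable lborel f"
  shows "cmod (qpft_L1 \<Lambda> f w) \<le> qpft_bound \<Lambda> * (LINT x|lborel. cmod (f x))"
proof -
  have "cmod (LINT x|lborel. qpft_kernel \<Lambda> w x * f x) \<le> (LINT x|lborel. cmod (qpft_kernel \<Lambda> w x * f x))"
    by (rule integral_norm_bound)
  then show ?thesis
    by (simp add: norm_mult qpft_L1_borel)
qed

text \<open>
  Writing \<open>|Q f|\<^sup>2 = Q f cnj (Q f)\<close> and expanding both factors, two interchanges of integrals bring the frequency
  integral inside, where it is evaluated by \<open>qpft_kernel_reproducing\<close>. The damping makes these interchanges
  legitimate, as \<open>Q f\<close> is only known to be bounded.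
\<close>
lemma qpft_L1_regularized_parseval:
  fixes f :: "real ^ 'n::finite \<Rightarrow> complex"
  assumes b: "\<And>k. par_b (\<Lambda> k) \<noteq> 0" and e: "0 < e"
    and f[measurable]: "f \<in> borel_measurable borel" and f1: "integrable lborel f"
  defines "h \<equiv> \<lambda>x. f x * qpft_chirp \<Lambda> x"
  shows "of_real (LINT w|lborel. qpft_damping \<Lambda> e w * (cmod (qpft_L1 \<Lambda> f w))\<^sup>2)
    = (LINT x|lborel. h x * cnj (LINT y|lborel. h y * gauss_density e (x - y)))"
proof -
  let ?K = "qpft_kernel \<Lambda>" and ?d = "\<lambda>w. complex_of_real (qpft_damping \<Lambda> e w)" and ?F = "qpft_L1 \<Lambda> f"
  note [measurable] = borel_measurable_qpft_L1[OF f]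
  have K1: "(\<lambda>(w, x). ?K w x) \<in> borel_measurable (borel \<Otimes>\<^sub>M borel)"
    using borel_measurable_qpft_kernel by (simp add: split_beta)
  have K2: "(\<lambda>(w, x). cnj (?K w x)) \<in> borel_measurable (borel \<Otimes>\<^sub>M borel)"
    using borel_measurable_cnj[OF borel_measurable_qpft_kernel] by (simp add: split_beta)
  have d: "integrable lborel (qpft_damping \<Lambda> e)"
    by (rule qpft_damping_integrable[OF b e])
  have u: "integrable lborel (\<lambda>w. ?d w * cnj (?F w))"
  proof (rule Bochner_Integration.integrable_bound)
    show "integrable lborel (\<lambda>w. (qpft_bound \<Lambda> * (LINT x|lborel. cmod (f x))) * qpft_damping \<Lambda> e w)"
      by (intro integrable_mult_right d)
    have "cmod (?d w * cnj (?F w)) \<le> (qpft_bound \<Lambda> * (LINT x|lborel. cmod (f x))) * qpft_damping \<Lambda> e w" for w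
      using mult_right_mono[OF norm_qpft_L1_le[OF f f1] qpft_damping_bounds(1)]
      by (simp add: norm_mult qpft_damping_bounds mult.commute)
    from order_trans[OF this abs_ge_self]
    show "AE w in lborel. norm (?d w * cnj (?F w)) \<le> norm ((qpft_bound \<Lambda> * (LINT x|lborel. cmod (f x))) * qpft_damping \<Lambda> e w)"
      by (simp only: real_norm_def AE_I2)
  qed measurable
  have inner: "(LINT w|lborel. ?K w x * (?d w * cnj (?F w)))
      = qpft_chirp \<Lambda> x * cnj (LINT y|lborel. h y * gauss_density e (x - y))" for x
  proof -
    have v: "integrable lborel (\<lambda>w. ?K w x * ?d w)"
    proof (rule Bochner_Integration.integrable_bound)
      show "integrable lborel (\<lambda>w. qpft_bound \<Lambda> * qpft_damping \<Lambda> e w)"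
        by (intro integrable_mult_right d)
    qed (auto simp: norm_mult)
    have F_cnj: "cnj (?F w) = (LINT y|lborel. cnj (?K w y) * cnj (f y))" for w
      unfolding qpft_L1_borel[OF f] by (simp flip: complex_cnj_mult)
    have "(LINT w|lborel. ?K w x * (?d w * cnj (?F w)))
        = (LINT w|lborel. (?K w x * ?d w) * (LINT y|lborel. cnj (?K w y) * cnj (f y)))"
      unfolding F_cnj by (simp only: mult.assoc)
    also have "\<dots> = (LINT y|lborel. cnj (f y) * (LINT w|lborel. cnj (?K w y) * (?K w x * ?d w)))"
      using f1 by (intro multiplication_formula[OF K2 _ v, where C="qpft_bound \<Lambda>"]) auto
    also have "\<dots> = (LINT y|lborel. cnj (f y) * (qpft_chirp \<Lambda> x * cnj (qpft_chirp \<Lambda> y) * of_real (gauss_density e (x - y))))"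
      unfolding qpft_kernel_reproducing(2)[where \<Lambda>=\<Lambda>, OF b e, symmetric]
      by (simp only: mult_ac)
    also have "\<dots> = (LINT y|lborel. qpft_chirp \<Lambda> x * cnj (h y * gauss_density e (x - y)))"
      by (simp add: h_def mult_ac)
    finally show ?thesis
      by (simp only: integral_mult_right_zero Bochner_Integration.integral_cnj)
  qed
  have "of_real (LINT w|lborel. qpft_damping \<Lambda> e w * (cmod (?F w))\<^sup>2)
      = (LINT w|lborel. (?d w * cnj (?F w)) * ?F w)"
    by (subst integral_complex_of_real[symmetric])
       (simp only: of_real_mult complex_norm_square mult_ac)
  also have "\<dots> = (LINT w|lborel. (?d w * cnj (?F w)) * (LINT x|lborel. ?K w x * f x))"
    by (simp add: qpft_L1_borel)
  also have "\<dots> = (LINT x|lborel. f x * (LINT w|lborel. ?K w x * (?d w * cnj (?F w))))"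
    by (rule multiplication_formula[OF K1 _ u f1, where C="qpft_bound \<Lambda>"]) simp
  also have "\<dots> = (LINT x|lborel. h x * cnj (LINT y|lborel. h y * gauss_density e (x - y)))"
    unfolding inner by (simp add: h_def mult.assoc)
  finally show ?thesis .
qed

lemma qpft_damping_integral_le:
  fixes f :: "real ^ 'n::finite \<Rightarrow> complex"
  assumes b: "\<And>k. par_b (\<Lambda> k) \<noteq> 0" and e: "0 < e"
    and f[measurable]: "f \<in> borel_measurable borel" and f1: "integrable lborel f"
    and f2: "integrable lborel (\<lambda>x. (cmod (f x))\<^sup>2)"
  shows "integrable lborel (\<lambda>w. qpft_damping \<Lambda> e w * (cmod (qpft_L1 \<Lambda> f w))\<^sup>2)"
    and "(LINT w|lborel. qpft_damping \<Lambda> e w * (cmod (qpft_L1 \<Lambda> f w))\<^sup>2) \<le> (LINT x|lborel. (cmod (f x))\<^sup>2)"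
proof -
  note [measurable] = borel_measurable_qpft_L1[OF f]
  let ?C = "(qpft_bound \<Lambda> * (LINT x|lborel. cmod (f x)))\<^sup>2"
  show "integrable lborel (\<lambda>w. qpft_damping \<Lambda> e w * (cmod (qpft_L1 \<Lambda> f w))\<^sup>2)"
  proof (rule Bochner_Integration.integrable_bound)
    show "integrable lborel (\<lambda>w. qpft_damping \<Lambda> e w * ?C)"
      by (intro integrable_mult_left qpft_damping_integrable[OF b e])
    have "\<bar>qpft_damping \<Lambda> e w * (cmod (qpft_L1 \<Lambda> f w))\<^sup>2\<bar> \<le> \<bar>qpft_damping \<Lambda> e w * ?C\<bar>" for w
      using norm_qpft_L1_le[OF f f1]
      by (auto simp: abs_mult qpft_damping_bounds intro!: mult_left_mono power_mono)
    then show "AE w in lborel. norm (qpft_damping \<Lambda> e w * (cmod (qpft_L1 \<Lambda> f w))\<^sup>2) \<le> norm (qpft_damping \<Lambda> e w * ?C)"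
      by (simp only: real_norm_def AE_I2)
  qed measurable
  have "\<bar>LINT w|lborel. qpft_damping \<Lambda> e w * (cmod (qpft_L1 \<Lambda> f w))\<^sup>2\<bar>
      = cmod (of_real (LINT w|lborel. qpft_damping \<Lambda> e w * (cmod (qpft_L1 \<Lambda> f w))\<^sup>2))"
    by (simp only: norm_of_real)
  also have "\<dots> \<le> (LINT x|lborel. (cmod (f x * qpft_chirp \<Lambda> x))\<^sup>2)"
    unfolding qpft_L1_regularized_parseval[OF b e f f1]
    using f2 e
    by (intro convolution_form_bound gauss_density_integral gauss_density_nonneg) (auto simp: norm_mult)
  also have "\<dots> = (LINT x|lborel. (cmod (f x))\<^sup>2)"
    by (simp add: norm_mult)
  finally show "(LINT w|lborel. qpft_damping \<Lambda> e w * (cmod (qpft_L1 \<Lambda> f w))\<^sup>2) \<le> (LINT x|lborel. (cmod (f x))\<^sup>2)"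
    by linarith
qed

text \<open>
  The bound for the damped integrals is uniform in the width, so Fatou's lemma along \<open>e = 1/(n+1)\<close> gives it
  for \<open>Q f\<close>. A Lebesgue measurable \<open>f\<close> is first replaced by a Borel function that is equal to it almost
  everywhere; this leaves its transform unchanged at every point.
\<close>
lemma qpft_L1_contraction:
  fixes f :: "real ^ 'n::finite \<Rightarrow> complex"
  assumes b: "\<And>k. par_b (\<Lambda> k) \<noteq> 0" and f2: "f \<in> L2_space" and f1: "integrable lebesgue f"
  shows "qpft_L1 \<Lambda> f \<in> L2_space" "L2_norm (qpft_L1 \<Lambda> f) \<le> L2_norm f"
proof -
  obtain g where g[measurable]: "g \<in> borel_measurable borel" and fg: "AE x in lebesgue. f x = g x"
    using lebesgue_ex_borel[OF L2_spaceD(1)[OF f2]] .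
  have g_leb[measurable]: "g \<in> borel_measurable lebesgue"
    by (rule measurable_completion) simp
  note [measurable] = L2_spaceD(1)[OF f2]
  have kernel_leb[measurable]: "qpft_kernel \<Lambda> w \<in> borel_measurable lebesgue" for w
    by (rule measurable_completion) simp
  have g2: "g \<in> L2_space"
    by (rule L2_space_cong_AE[OF f2 g_leb fg])
  have g1: "integrable lborel g"
    using integrable_cong_AE_imp[OF f1 g_leb] fg L2_space_borel_iff(3)[OF g] by (simp add: eq_commute)
  have Qeq: "qpft_L1 \<Lambda> f = qpft_L1 \<Lambda> g"
    unfolding qpft_L1_def by (intro ext integral_cong_AE) (use fg in auto)
  note F[measurable] = borel_measurable_qpft_L1[OF g]
  have g2': "integrable lborel (\<lambda>x. (cmod (g x))\<^sup>2)"
    using g2 L2_space_borel_iff(1)[OF g] by simp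
  define e where "e n = 1 / real (Suc n)" for n
  have e: "0 < e n" "e \<longlonglongrightarrow> 0" for n
    using LIMSEQ_inverse_real_of_nat by (auto simp: e_def[abs_def] inverse_eq_divide)
  define G where "G n w = of_real (sqrt (qpft_damping \<Lambda> (e n) w)) * qpft_L1 \<Lambda> g w" for n w
  have G[measurable]: "G n \<in> borel_measurable borel" for n
    unfolding G_def by measurable
  have G_sq: "(cmod (G n w))\<^sup>2 = qpft_damping \<Lambda> (e n) w * (cmod (qpft_L1 \<Lambda> g w))\<^sup>2" for n w
    by (simp add: G_def norm_mult power_mult_distrib qpft_damping_bounds)
  note G_int = qpft_damping_integral_le[OF b e(1) g g1 g2']
  have G2: "G n \<in> L2_space" for n
    unfolding L2_space_borel_iff(1)[OF G] G_sq by (rule G_int)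
  have "(L2_norm (G n))\<^sup>2 \<le> (L2_norm g)\<^sup>2" for n
    unfolding L2_space_borel_iff(2)[OF G] L2_space_borel_iff(2)[OF g] G_sq by (rule G_int)
  then have le: "L2_norm (G n) \<le> L2_norm g" for n
    by (rule power2_le_imp_le) (rule L2_norm_nonneg)
  have lim: "(\<lambda>n. G n w) \<longlonglongrightarrow> qpft_L1 \<Lambda> g w" for w
  proof -
    have "(\<lambda>n. G n w) \<longlonglongrightarrow> of_real (sqrt 1) * qpft_L1 \<Lambda> g w"
      unfolding G_def by (intro tendsto_intros qpft_damping_tendsto e)
    then show ?thesis by simp
  qed
  have Fl: "qpft_L1 \<Lambda> g \<in> borel_measurable lebesgue"
    by (rule measurable_completion) simp
  note * = L2_fatou[OF G2 always_eventually[OF allI[OF le]] AE_I2[OF lim] Fl]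
  show "qpft_L1 \<Lambda> f \<in> L2_space" unfolding Qeq by (rule *)
  show "L2_norm (qpft_L1 \<Lambda> f) \<le> L2_norm f"
    unfolding Qeq using * L2_norm_cong_AE[OF _ g_leb fg] by simp
qed

lemma qpft_L1_diff:
  assumes f: "integrable lebesgue f" and g: "integrable lebesgue g"
  shows "qpft_L1 \<Lambda> (\<lambda>x. f x - g x) = (\<lambda>w. qpft_L1 \<Lambda> f w - qpft_L1 \<Lambda> g w)"
proof -
  have kernel_leb[measurable]: "qpft_kernel \<Lambda> w \<in> borel_measurable lebesgue" for w
    by (rule measurable_completion) simp
  have int: "integrable lebesgue (\<lambda>x. qpft_kernel \<Lambda> w x * f x)" if "integrable lebesgue f" for f w
    using borel_measurable_integrable[OF that]
    by (intro Bochner_Integration.integrable_bound[OF integrable_mult_right[OF that, of "of_real (qpft_bound \<Lambda>)"]])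
       (auto simp: norm_mult qpft_bound_nonneg)
  show ?thesis
    unfolding qpft_L1_def by (simp add: right_diff_distrib Bochner_Integration.integral_diff[OF int[OF f] int[OF g]])
qed

lemma is_L2_extension_qpft_L1:
  fixes \<Lambda> :: "'n::finite \<Rightarrow> qp_param"
  assumes b: "\<And>k. par_b (\<Lambda> k) \<noteq> 0"
  shows "is_L2_extension (qpft_L1 \<Lambda>) (L2_extension (qpft_L1 \<Lambda>))"
proof (rule is_L2_extension_of_contraction)
  show "qpft_L1 \<Lambda> f \<in> L2_space" if "f \<in> L2_space" "integrable lebesgue f" for f
    by (rule qpft_L1_contraction[OF b that])
  show "L2_norm (\<lambda>w. qpft_L1 \<Lambda> f w - qpft_L1 \<Lambda> g w) \<le> L2_norm (\<lambda>x. f x - g x)"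
    if "f \<in> L2_space" "integrable lebesgue f" "g \<in> L2_space" "integrable lebesgue g" for f g
    using qpft_L1_contraction(2)[OF b L2_space_diff[OF that(1,3)] Bochner_Integration.integrable_diff[OF that(2,4)]]
    by (simp add: qpft_L1_diff that)
qed

text \<open>
  Both sides of the regularized Parseval identity converge as the damping is removed: the left-hand side by
  domination, now that \<open>|Q f|\<^sup>2\<close> is known to be integrable, and the right-hand side by the approximate identity.
\<close>
lemma qpft_L1_isometry:
  fixes f :: "real ^ 'n::finite \<Rightarrow> complex"
  assumes b: "\<And>k. par_b (\<Lambda> k) \<noteq> 0" and f: "continuous_compact_support f"
  shows "L2_norm (qpft_L1 \<Lambda> f) = L2_norm f"
proof -
  note fD = continuous_compact_supportD[OF f]
  note fm[measurable] = fD(2)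
  note F[measurable] = borel_measurable_qpft_L1[OF fm]
  have f1: "integrable lborel f"
    using fD(3) L2_space_borel_iff(3)[OF fm] by simp
  obtain B where B: "\<And>x. cmod (f x) \<le> B"
    using fD(5) by auto
  have "qpft_L1 \<Lambda> f \<in> L2_space"
    by (rule qpft_L1_contraction[OF b fD(4,3)])
  then have F2: "integrable lborel (\<lambda>w. (cmod (qpft_L1 \<Lambda> f w))\<^sup>2)"
    using L2_space_borel_iff(1)[OF F] by simp
  define e where "e n = 1 / real (Suc n)" for n
  have e: "0 < e n" "e \<longlonglongrightarrow> 0" for n
    using LIMSEQ_inverse_real_of_nat by (auto simp: e_def[abs_def] inverse_eq_divide)
  define h where "h x = f x * qpft_chirp \<Lambda> x" for x
  have h_cont: "continuous_on UNIV h"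
    unfolding h_def by (intro continuous_intros fD continuous_on_qpft_chirp)
  have h_bound: "cmod (h x) \<le> B" for x
    using B by (simp add: h_def norm_mult)
  have h_int: "integrable lborel h"
    unfolding h_def by (rule Bochner_Integration.integrable_bound[OF f1]) (auto simp: norm_mult)
  note [measurable] = borel_measurable_integrable[OF h_int, simplified]
  note approx = gauss_density_approximate_identity[OF h_cont h_bound e]
  have lim1: "(\<lambda>n. LINT x|lborel. h x * cnj (LINT y|lborel. h y * gauss_density (e n) (x - y)))
      \<longlonglongrightarrow> (LINT x|lborel. h x * cnj (h x))"
  proof (rule integral_dominated_convergence)
    show "integrable lborel (\<lambda>x. cmod (h x) * B)"
      using h_int by (intro integrable_mult_left integrable_norm)
    show "AE x in lborel. (\<lambda>n. h x * cnj (LINT y|lborel. h y * gauss_density (e n) (x - y))) \<longlonglongrightarrow> h x * cnj (h x)"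
      by (intro AE_I2 tendsto_intros approx)
    show "AE x in lborel. norm (h x * cnj (LINT y|lborel. h y * gauss_density (e n) (x - y))) \<le> cmod (h x) * B" for n
      using approx(2) by (auto simp: norm_mult intro!: mult_left_mono)
  qed measurable
  have "(\<lambda>n. LINT w|lborel. qpft_damping \<Lambda> (e n) w * (cmod (qpft_L1 \<Lambda> f w))\<^sup>2)
      \<longlonglongrightarrow> (LINT w|lborel. (cmod (qpft_L1 \<Lambda> f w))\<^sup>2)"
  proof (rule integral_dominated_convergence[OF _ _ F2])
    show "AE w in lborel. (\<lambda>n. qpft_damping \<Lambda> (e n) w * (cmod (qpft_L1 \<Lambda> f w))\<^sup>2) \<longlonglongrightarrow> (cmod (qpft_L1 \<Lambda> f w))\<^sup>2"
    proof (rule AE_I2)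
      fix w
      have "(\<lambda>n. qpft_damping \<Lambda> (e n) w * (cmod (qpft_L1 \<Lambda> f w))\<^sup>2) \<longlonglongrightarrow> 1 * (cmod (qpft_L1 \<Lambda> f w))\<^sup>2"
        by (intro tendsto_intros qpft_damping_tendsto e)
      then show "(\<lambda>n. qpft_damping \<Lambda> (e n) w * (cmod (qpft_L1 \<Lambda> f w))\<^sup>2) \<longlonglongrightarrow> (cmod (qpft_L1 \<Lambda> f w))\<^sup>2"
        by simp
    qed
    show "AE w in lborel. norm (qpft_damping \<Lambda> (e n) w * (cmod (qpft_L1 \<Lambda> f w))\<^sup>2) \<le> (cmod (qpft_L1 \<Lambda> f w))\<^sup>2" for n
      by (intro AE_I2) (simp add: abs_mult qpft_damping_bounds mult_left_le_one_le)
  qed measurable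
  then have "(\<lambda>n. complex_of_real (LINT w|lborel. qpft_damping \<Lambda> (e n) w * (cmod (qpft_L1 \<Lambda> f w))\<^sup>2))
      \<longlonglongrightarrow> of_real (LINT w|lborel. (cmod (qpft_L1 \<Lambda> f w))\<^sup>2)"
    by (rule tendsto_of_real)
  then have "(\<lambda>n. LINT x|lborel. h x * cnj (LINT y|lborel. h y * gauss_density (e n) (x - y)))
      \<longlonglongrightarrow> of_real (LINT w|lborel. (cmod (qpft_L1 \<Lambda> f w))\<^sup>2)"
    unfolding qpft_L1_regularized_parseval[OF b e(1) fm f1] h_def .
  from LIMSEQ_unique[OF this lim1]
  have "complex_of_real (LINT w|lborel. (cmod (qpft_L1 \<Lambda> f w))\<^sup>2) = (LINT x|lborel. of_real ((cmod (h x))\<^sup>2))"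
    unfolding complex_norm_square .
  also have "\<dots> = of_real (LINT x|lborel. (cmod (h x))\<^sup>2)"
    by (rule integral_complex_of_real)
  also have "(LINT x|lborel. (cmod (h x))\<^sup>2) = (LINT x|lborel. (cmod (f x))\<^sup>2)"
    by (simp add: h_def norm_mult)
  finally have "(L2_norm (qpft_L1 \<Lambda> f))\<^sup>2 = (L2_norm f)\<^sup>2"
    unfolding L2_space_borel_iff(2)[OF F] L2_space_borel_iff(2)[OF fm] by (simp only: of_real_eq_iff)
  then show ?thesis
    by (rule power2_eq_imp_eq) (rule L2_norm_nonneg)+
qed

section \<open>The backward transform as dual and as adjoint\<close>

text \<open>
  The parameter for which the forward kernel, with its two arguments exchanged, is the backward kernel.
\<close>
definition qpft_dual :: "('n::finite \<Rightarrow> qp_param) \<Rightarrow> 'n \<Rightarrow> qp_param" where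
  "qpft_dual \<Lambda> k = \<lparr>par_a = - par_c (\<Lambda> k), par_b = - par_b (\<Lambda> k), par_c = - par_a (\<Lambda> k),
     par_d = - par_e (\<Lambda> k), par_e = - par_d (\<Lambda> k)\<rparr>"

lemma par_b_qpft_dual: "par_b (qpft_dual \<Lambda> k) = - par_b (\<Lambda> k)"
  by (simp add: qpft_dual_def)

lemma qp_phase_dual: "qp_phase (qpft_dual \<Lambda> k) x w = - qp_phase (\<Lambda> k) w x"
  by (simp add: qp_phase_def qpft_dual_def algebra_simps)

lemma qpft_kernel_neg_eq_dual: "qpft_kernel_neg \<Lambda> w x = qpft_kernel (qpft_dual \<Lambda>) x w"
proof -
  have "\<beta> * \<i> / (2 * of_real pi) = - \<beta> / (2 * of_real pi * \<i>)" for \<beta> :: complex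
    by (simp add: field_simps)
  then show ?thesis
    by (simp add: qpft_kernel_neg_def qpft_kernel_def qp_phase_dual par_b_qpft_dual)
qed

lemma qpft_neg_L1_eq_dual: "qpft_neg_L1 \<Lambda> = qpft_L1 (qpft_dual \<Lambda>)"
  by (intro ext) (simp add: qpft_neg_L1_def qpft_L1_def qpft_kernel_neg_eq_dual)

text \<open>
  The principal square root commutes with conjugation off the negative real axis. The constants of the kernel
  are purely imaginary and, as \<open>b\<^sub>k\<close> does not vanish, nonzero, so they avoid its branch cut.
\<close>
lemma qpft_kernel_neg_eq_cnj:
  assumes b: "\<And>k. par_b (\<Lambda> k) \<noteq> 0"
  shows "qpft_kernel_neg \<Lambda> w x = cnj (qpft_kernel \<Lambda> w x)"
proof -
  have conversion: "\<beta> * \<i> / (2 * of_real pi) = - (\<beta> / (2 * of_real pi * \<i>))" for \<beta> :: complex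
    by (simp add: field_simps)
  have "cnj (csqrt (of_real \<beta> / (2 * of_real pi * \<i>))) = csqrt (of_real \<beta> * \<i> / (2 * of_real pi))"
    if "\<beta> \<noteq> 0" for \<beta> :: real
  proof -
    have "Im (of_real \<beta> / (2 * of_real pi * \<i>)) \<noteq> 0"
      using that by (simp add: Im_divide)
    then have "of_real \<beta> / (2 * of_real pi * \<i>) \<notin> \<real>\<^sub>\<le>\<^sub>0"
      by (simp add: complex_nonpos_Reals_iff)
    from cnj_csqrt[OF this] show ?thesis
      by (simp add: conversion)
  qed
  then show ?thesis
    by (simp add: qpft_kernel_neg_def qpft_kernel_def b exp_cnj)
qed

lemma qpft_adjoint:
  fixes f g :: "real ^ 'n::finite \<Rightarrow> complex"
  assumes b: "\<And>k. par_b (\<Lambda> k) \<noteq> 0"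
    and f[measurable]: "f \<in> borel_measurable borel" and f1: "integrable lborel f"
    and g[measurable]: "g \<in> borel_measurable borel" and g1: "integrable lborel g"
  shows "(LINT x|lborel. cnj (f x) * qpft_neg_L1 \<Lambda> g x) = (LINT w|lborel. g w * cnj (qpft_L1 \<Lambda> f w))"
proof -
  have K: "(\<lambda>(x, w). qpft_kernel_neg \<Lambda> w x) \<in> borel_measurable (borel \<Otimes>\<^sub>M borel)"
    using borel_measurable_qpft_kernel by (simp add: split_beta qpft_kernel_neg_eq_dual)
  have "(LINT x|lborel. cnj (f x) * qpft_neg_L1 \<Lambda> g x)
      = (LINT x|lborel. cnj (f x) * (LINT w|lborel. qpft_kernel_neg \<Lambda> w x * g w))"
    by (simp add: qpft_neg_L1_eq_dual qpft_L1_borel qpft_kernel_neg_eq_dual)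
  also have "\<dots> = (LINT w|lborel. g w * (LINT x|lborel. qpft_kernel_neg \<Lambda> w x * cnj (f x)))"
    using f1 g1 by (intro multiplication_formula[OF K, where C="qpft_bound (qpft_dual \<Lambda>)"])
      (auto simp: qpft_kernel_neg_eq_dual)
  also have "(\<lambda>w. LINT x|lborel. qpft_kernel_neg \<Lambda> w x * cnj (f x)) = (\<lambda>w. cnj (qpft_L1 \<Lambda> f w))"
    by (simp add: qpft_L1_borel qpft_kernel_neg_eq_cnj[OF b] flip: complex_cnj_mult)
  finally show ?thesis .
qed

section \<open>Inversion\<close>

text \<open>
  This is \<open>Q* Q = 1\<close> in quantitative form: by adjointness the inner product of \<open>Q' (G n)\<close> and \<open>f\<close> is that of
  \<open>G n\<close> and \<open>Q f\<close>, which equals \<open>\<parallel>G n\<parallel>\<^sup>2\<close> because \<open>G n\<close> is a truncation of \<open>Q f\<close>; then \<open>\<parallel>G n\<parallel>\<close> tends to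
  \<open>\<parallel>Q f\<parallel> = \<parallel>f\<parallel>\<close>.
\<close>
lemma qpft_neg_truncated_tendsto:
  fixes f :: "real ^ 'n::finite \<Rightarrow> complex"
  assumes b: "\<And>k. par_b (\<Lambda> k) \<noteq> 0" and f: "continuous_compact_support f"
  defines "G \<equiv> \<lambda>n w. indicat_real (cball 0 (real n)) w *\<^sub>R qpft_L1 \<Lambda> f w"
  shows "\<And>n. G n \<in> L2_space" "\<And>n. integrable lebesgue (G n)"
    and "(\<lambda>n. L2_norm (\<lambda>w. G n w - qpft_L1 \<Lambda> f w)) \<longlonglongrightarrow> 0"
    and "(\<lambda>n. L2_norm (\<lambda>x. qpft_neg_L1 \<Lambda> (G n) x - f x)) \<longlonglongrightarrow> 0"
proof -
  note fD = continuous_compact_supportD[OF f]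
  note fm[measurable] = fD(2)
  note F[measurable] = borel_measurable_qpft_L1[OF fm]
  have b': "par_b (qpft_dual \<Lambda> k) \<noteq> 0" for k
    using b by (simp add: par_b_qpft_dual)
  have f1: "integrable lborel f"
    using fD(3) L2_space_borel_iff(3)[OF fm] by simp
  have F2: "qpft_L1 \<Lambda> f \<in> L2_space"
    by (rule qpft_L1_contraction[OF b fD(4,3)])
  have G[measurable]: "G n \<in> borel_measurable borel" for n
    unfolding G_def by (intro borel_measurable_scaleR borel_measurable_indicator F) auto
  have Gl: "G n \<in> borel_measurable lebesgue" for n
    by (rule measurable_completion) simp
  let ?C = "qpft_bound \<Lambda> * (LINT x|lborel. cmod (f x))"
  have G_le: "cmod (G n w) \<le> cmod (qpft_L1 \<Lambda> f w)" for n w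
    by (simp add: G_def indicator_def)
  have G_bd: "cmod (G n w) \<le> ?C" for n w
    using G_le norm_qpft_L1_le[OF fm f1] by (rule order_trans)
  have G_supp: "G n w = 0" if "real n < norm w" for n w
    using that by (simp add: G_def indicator_def)
  show G1: "integrable lebesgue (G n)" and G2: "G n \<in> L2_space" for n
    using bounded_support_integrable_L2[OF Gl G_bd G_supp] by auto
  show lim: "(\<lambda>n. L2_norm (\<lambda>w. G n w - qpft_L1 \<Lambda> f w)) \<longlonglongrightarrow> 0"
  proof (rule L2_dominated_convergence[OF L2_spaceD(2)[OF F2] Gl L2_spaceD(1)[OF F2]])
    show "AE w in lebesgue. (\<lambda>n. G n w) \<longlonglongrightarrow> qpft_L1 \<Lambda> f w"
    proof (intro AE_I2 tendsto_eventually eventually_sequentiallyI)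
      fix w :: "real ^ 'n" and n assume "nat \<lceil>norm w\<rceil> \<le> n"
      then show "G n w = qpft_L1 \<Lambda> f w"
        by (simp add: G_def nat_le_iff ceiling_le_iff)
    qed
  qed (use G_le in auto)
  have bound: "(L2_norm (\<lambda>x. qpft_neg_L1 \<Lambda> (G n) x - f x))\<^sup>2 \<le> (L2_norm f)\<^sup>2 - (L2_norm (G n))\<^sup>2" for n
  proof -
    note u = borel_measurable_qpft_L1[OF G[of n], of "qpft_dual \<Lambda>", folded qpft_neg_L1_eq_dual]
    note u2 = qpft_L1_contraction[where \<Lambda>="qpft_dual \<Lambda>", OF b' G2[of n] G1[of n], folded qpft_neg_L1_eq_dual]
    have "(LINT x|lborel. cnj (f x) * qpft_neg_L1 \<Lambda> (G n) x) = (LINT w|lborel. G n w * cnj (qpft_L1 \<Lambda> f w))"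
      using G1[of n] L2_space_borel_iff(3)[OF G] by (intro qpft_adjoint b f1 fm G) auto
    also have "\<dots> = (LINT w|lborel. of_real ((cmod (G n w))\<^sup>2))"
      unfolding complex_norm_square
      by (rule arg_cong[where f="integral\<^sup>L lborel"]) (auto simp: G_def indicator_def)
    also have "\<dots> = of_real ((L2_norm (G n))\<^sup>2)"
      unfolding L2_space_borel_iff(2)[OF G] by (rule integral_complex_of_real)
    finally have "(L2_norm (\<lambda>x. qpft_neg_L1 \<Lambda> (G n) x - f x))\<^sup>2
        = (L2_norm (qpft_neg_L1 \<Lambda> (G n)))\<^sup>2 - 2 * (L2_norm (G n))\<^sup>2 + (L2_norm f)\<^sup>2"
      by (intro L2_norm_diff_power2 u u2 fm fD)
    moreover have "(L2_norm (qpft_neg_L1 \<Lambda> (G n)))\<^sup>2 \<le> (L2_norm (G n))\<^sup>2"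
      by (intro power_mono u2 L2_norm_nonneg)
    ultimately show ?thesis by linarith
  qed
  have "(\<lambda>n. L2_norm (G n)) \<longlonglongrightarrow> L2_norm f"
  proof (rule LIM_zero_cancel, rule Lim_null_comparison[OF always_eventually[OF allI] lim])
    fix n
    have "L2_norm (G n) \<le> L2_norm (\<lambda>w. G n w - qpft_L1 \<Lambda> f w) + L2_norm (qpft_L1 \<Lambda> f)"
      using L2_norm_triangle[OF L2_space_diff[OF G2 F2] F2] by simp
    moreover have "L2_norm (qpft_L1 \<Lambda> f) \<le> L2_norm (\<lambda>w. qpft_L1 \<Lambda> f w - G n w) + L2_norm (G n)"
      using L2_norm_triangle[OF L2_space_diff[OF F2 G2[of n]] G2[of n]] by simp
    ultimately show "norm (L2_norm (G n) - L2_norm f) \<le> L2_norm (\<lambda>w. G n w - qpft_L1 \<Lambda> f w)"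
      using qpft_L1_isometry[OF b f] L2_norm_commute[of "G n" "qpft_L1 \<Lambda> f"]
      by (simp add: abs_le_iff)
  qed
  then have "(\<lambda>n. sqrt ((L2_norm f)\<^sup>2 - (L2_norm (G n))\<^sup>2)) \<longlonglongrightarrow> sqrt ((L2_norm f)\<^sup>2 - (L2_norm f)\<^sup>2)"
    by (intro tendsto_intros)
  then have "(\<lambda>n. sqrt ((L2_norm f)\<^sup>2 - (L2_norm (G n))\<^sup>2)) \<longlonglongrightarrow> 0"
    by simp
  then show "(\<lambda>n. L2_norm (\<lambda>x. qpft_neg_L1 \<Lambda> (G n) x - f x)) \<longlonglongrightarrow> 0"
  proof (rule Lim_null_comparison[OF always_eventually[OF allI], rotated])
    show "norm (L2_norm (\<lambda>x. qpft_neg_L1 \<Lambda> (G n) x - f x)) \<le> sqrt ((L2_norm f)\<^sup>2 - (L2_norm (G n))\<^sup>2)" for n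
      using real_le_rsqrt[OF bound[of n]] L2_norm_nonneg[of "\<lambda>x. qpft_neg_L1 \<Lambda> (G n) x - f x"]
      by simp
  qed
qed

text \<open>
  \<open>T'\<close> is continuous at \<open>T f\<close>, the limit of the truncations \<open>G n\<close>, and on these integrable functions it
  agrees with the integral transform, whose values converge to \<open>f\<close>.
\<close>
lemma qpft_inversion_continuous_compact_support:
  fixes f :: "real ^ 'n::finite \<Rightarrow> complex"
  assumes b: "\<And>k. par_b (\<Lambda> k) \<noteq> 0" and f: "continuous_compact_support f"
    and T: "is_L2_extension (qpft_L1 \<Lambda>) T" and T': "is_L2_extension (qpft_neg_L1 \<Lambda>) T'"
  shows "AE x in lebesgue. T' (T f) x = f x"
proof (rule L2_AE_eqI)
  note fD = continuous_compact_supportD[OF f]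
  note TD = is_L2_extensionD[OF T] and TD' = is_L2_extensionD[OF T']
  show TTf: "T' (T f) \<in> L2_space" by (intro TD TD' fD)
  show "f \<in> L2_space" by (rule fD)
  fix e :: real assume e: "0 < e"
  define G where "G n w = indicat_real (cball 0 (real n)) w *\<^sub>R qpft_L1 \<Lambda> f w" for n w
  note G = qpft_neg_truncated_tendsto[where \<Lambda>=\<Lambda>, OF b f, folded G_def]
  have F2: "qpft_L1 \<Lambda> f \<in> L2_space"
    by (rule qpft_L1_contraction[OF b fD(4,3)])
  obtain d where d: "0 < d" "\<And>g. g \<in> L2_space \<Longrightarrow> L2_norm (\<lambda>x. g x - T f x) < d \<Longrightarrow> L2_norm (\<lambda>x. T' g x - T' (T f) x) < e / 2"
    using TD'(3)[OF TD(1)[OF fD(4)], of "e / 2"] e by auto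
  have "\<forall>\<^sub>F n in sequentially. L2_norm (\<lambda>w. G n w - qpft_L1 \<Lambda> f w) < d \<and> L2_norm (\<lambda>x. qpft_neg_L1 \<Lambda> (G n) x - f x) < e / 2"
    using e by (intro eventually_conj order_tendstoD(2)[OF G(3) d(1)] order_tendstoD(2)[OF G(4)]) simp
  from eventually_happens[OF this] obtain n where n: "L2_norm (\<lambda>w. G n w - qpft_L1 \<Lambda> f w) < d" "L2_norm (\<lambda>x. qpft_neg_L1 \<Lambda> (G n) x - f x) < e / 2"
    by auto
  have "L2_norm (\<lambda>w. G n w - T f w) = L2_norm (\<lambda>w. G n w - qpft_L1 \<Lambda> f w)"
  proof (rule L2_norm_cong_AE)
    show "AE w in lebesgue. G n w - T f w = G n w - qpft_L1 \<Lambda> f w"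
      using TD(2)[OF fD(4,3)] by eventually_elim simp
  qed (intro L2_spaceD L2_space_diff G TD fD F2)+
  then have 1: "L2_norm (\<lambda>x. T' (G n) x - T' (T f) x) < e / 2"
    using n(1) by (intro d G) simp
  have Q2: "qpft_neg_L1 \<Lambda> (G n) \<in> L2_space"
    unfolding qpft_neg_L1_eq_dual using b by (intro qpft_L1_contraction G) (simp add: par_b_qpft_dual)
  have "L2_norm (\<lambda>x. T' (G n) x - f x) = L2_norm (\<lambda>x. qpft_neg_L1 \<Lambda> (G n) x - f x)"
  proof (rule L2_norm_cong_AE)
    show "AE x in lebesgue. T' (G n) x - f x = qpft_neg_L1 \<Lambda> (G n) x - f x"
      using TD'(2)[OF G(1,2)] by eventually_elim simp
  qed (intro L2_spaceD L2_space_diff G TD' fD Q2)+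
  then have 2: "L2_norm (\<lambda>x. T' (G n) x - f x) < e / 2"
    using n(2) by simp
  have "L2_norm (\<lambda>x. T' (T f) x - f x) \<le> L2_norm (\<lambda>x. T' (T f) x - T' (G n) x) + L2_norm (\<lambda>x. T' (G n) x - f x)"
    by (intro L2_norm_diff_triangle TTf TD' G fD)
  with 1 2 show "L2_norm (\<lambda>x. T' (T f) x - f x) < e"
    using L2_norm_commute[of "T' (T f)" "T' (G n)"] by linarith
qed

theorem theorem4p5:
  fixes \<Lambda> :: "'n::finite \<Rightarrow> qp_param"
    and f :: "real ^ 'n \<Rightarrow> complex"
  assumes "\<And>k. par_b (\<Lambda> k) \<noteq> 0"
    and "f \<in> L2_space"
  shows "AE x in lebesgue. (qpft_neg \<Lambda> \<circ> qpft \<Lambda>) f x = f x"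
proof -
  note f = assms(2)
  have T: "is_L2_extension (qpft_L1 \<Lambda>) (qpft \<Lambda>)"
    unfolding qpft_def by (rule is_L2_extension_qpft_L1[OF assms(1)])
  have T': "is_L2_extension (qpft_neg_L1 \<Lambda>) (qpft_neg \<Lambda>)"
    unfolding qpft_neg_def qpft_neg_L1_eq_dual
    using assms(1) by (intro is_L2_extension_qpft_L1) (simp add: par_b_qpft_dual)
  note TD = is_L2_extensionD[OF T] and TD' = is_L2_extensionD[OF T']
  have TTL2: "qpft_neg \<Lambda> (qpft \<Lambda> g) \<in> L2_space" if "g \<in> L2_space" for g
    by (intro TD TD' that)
  have "AE x in lebesgue. qpft_neg \<Lambda> (qpft \<Lambda> f) x = f x"
  proof (rule L2_AE_eqI[OF TTL2[OF f] f])
    fix e :: real assume e: "0 < e"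
    obtain d' where d': "0 < d'" "\<And>g. g \<in> L2_space \<Longrightarrow> L2_norm (\<lambda>x. g x - qpft \<Lambda> f x) < d'
        \<Longrightarrow> L2_norm (\<lambda>x. qpft_neg \<Lambda> g x - qpft_neg \<Lambda> (qpft \<Lambda> f) x) < e / 2"
      using TD'(3)[OF TD(1)[OF f], of "e / 2"] e by auto
    obtain d where d: "0 < d" "\<And>g. g \<in> L2_space \<Longrightarrow> L2_norm (\<lambda>x. g x - f x) < d
        \<Longrightarrow> L2_norm (\<lambda>x. qpft \<Lambda> g x - qpft \<Lambda> f x) < d'"
      using TD(3)[OF f d'(1)] by auto
    obtain g where g: "continuous_compact_support g" "L2_norm (\<lambda>x. g x - f x) < min d (e / 2)"
      using continuous_compact_support_dense[OF f, of "min d (e / 2)"] d(1) e by auto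
    note g2 = continuous_compact_supportD(4)[OF g(1)]
    have "L2_norm (\<lambda>x. qpft_neg \<Lambda> (qpft \<Lambda> g) x - qpft_neg \<Lambda> (qpft \<Lambda> f) x) < e / 2"
      using g by (intro d' d TD g2) simp
    moreover have "L2_norm (\<lambda>x. qpft_neg \<Lambda> (qpft \<Lambda> g) x - qpft_neg \<Lambda> (qpft \<Lambda> f) x)
        = L2_norm (\<lambda>x. g x - qpft_neg \<Lambda> (qpft \<Lambda> f) x)"
    proof (rule L2_norm_cong_AE)
      show "AE x in lebesgue. qpft_neg \<Lambda> (qpft \<Lambda> g) x - qpft_neg \<Lambda> (qpft \<Lambda> f) x = g x - qpft_neg \<Lambda> (qpft \<Lambda> f) x"
        using qpft_inversion_continuous_compact_support[OF assms(1) g(1) T T'] by eventually_elim simp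
    qed (intro L2_spaceD L2_space_diff TTL2 g2 f)+
    moreover have "L2_norm (\<lambda>x. qpft_neg \<Lambda> (qpft \<Lambda> f) x - f x)
        \<le> L2_norm (\<lambda>x. qpft_neg \<Lambda> (qpft \<Lambda> f) x - g x) + L2_norm (\<lambda>x. g x - f x)"
      by (intro L2_norm_diff_triangle TTL2 g2 f)
    ultimately show "L2_norm (\<lambda>x. qpft_neg \<Lambda> (qpft \<Lambda> f) x - f x) < e"
      using g(2) L2_norm_commute[of "qpft_neg \<Lambda> (qpft \<Lambda> f)" g] by simp
  qed
  then show ?thesis by simp
qed

end
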